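(* Let $N\ge2$ and $f$ be as in the context. There exists $R_1>0$ (depending only on $N$ and $f$) such that for every $\Omega$ as in the context, if for some $R>R_1$ and some $L,C>0$: - $\mathbb{R}\times B'_R\subset\Omega$, - $\Omega_L^r:=\{(x_1,x')\in\Omega:\ x_1>L\}$ is convex, - $\{x\in\Omega:\ x_1<L+R\}\subset\mathbb{R}\times B'_C$, - for all $x=(x_1,x')\in\partial\Omega$ with $x_1<L+R$, one has $\nu_1(x)\le0$, where $\nu_1(x)$ is the first component of the outward unit normal at $x$, then the invasion is complete, namely $u_\infty\equiv1$ in $\Omega$.
   Context: Points of $\mathbb{R}^N$ are written $x=(x_1,x')$ with $x_1\in\mathbb{R}$, $x'\in\mathbb{R}^{N-1}$. $B'_R$ is the open ball of radius $R$ centred at $0$ in $\mathbb{R}^{N-1}$. The outward unit normal of $\Omega$ is $\nu=(\nu_1,\nu')\in\mathbb{R}\times\mathbb{R}^{N-1}$. Domain: $\Omega\subset\mathbb{R}^N$ is an unbounded, uniformly $C^{2,\alpha}$ domain such that $\Omega\cap\{x_1<0\}=(-\infty,0)\times\omega$ for an open set $\omega\subset\mathbb{R}^{N-1}$. Nonlinearity: $f\in C^{1,1}([0,1])$ and there is $\theta\in(0,1)$ with $f(0)=f(\theta)=f(1)=0$, $f'(0)<0$, $f'(1)<0$, $f<0$ on $(0,\theta)$, $f>0$ on $(\theta,1)$; moreover $\int_0^1 f(s)\,ds>0$. Travelling front: $(\varphi,c)$, with $c>0$, is the unique solution of $\varphi''+c\varphi'+f(\varphi)=0$ in $\mathbb{R}$,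 $\varphi(-\infty)=1$, $\varphi(+\infty)=0$, $\varphi(0)=\theta$. Solution $u$: $u$ is the unique entire solution (defined for all $t\in\mathbb{R}$, with $0<u<1$) of $\partial_t u-\Delta u=f(u)$ in $\mathbb{R}\times\Omega$, $\partial_\nu u=0$ on $\mathbb{R}\times\partial\Omega$, such that $u(t,x)-\varphi(x_1-ct)\to0$ as $t\to-\infty$ uniformly in $\overline\Omega$. It is increasing in $t$, and $u_\infty:=\lim_{t\to+\infty}u(t,\cdot)$ (limit in $C^2_{loc}(\Omega)$) is a stationary solution. *)

theory Defs
  imports "HOL-Analysis.Analysis"
begin

section \<open>Partial derivatives, smooth functions and smooth domains\<close>

definition partial :: "'a \<Rightarrow> ('a::euclidean_space \<Rightarrow> real) \<Rightarrow> 'a \<Rightarrow> real" where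
  "partial b v x = frechet_derivative v (at x) b"

definition laplacian :: "('a::euclidean_space \<Rightarrow> real) \<Rightarrow> 'a \<Rightarrow> real" where
  "laplacian v x = (\<Sum>b\<in>Basis. partial b (partial b v) x)"

text \<open>Meant for open \<open>S\<close> only.\<close>

definition C2_on :: "'a::euclidean_space set \<Rightarrow> ('a \<Rightarrow> real) \<Rightarrow> bool" where
  "C2_on S v \<longleftrightarrow>
     (\<forall>x\<in>S. v differentiable (at x)) \<and>
     (\<forall>b\<in>Basis. \<forall>x\<in>S. partial b v differentiable (at x)) \<and>
     (\<forall>a\<in>Basis. \<forall>b\<in>Basis. continuous_on S (partial a (partial b v)))"

text \<open>Convergence in \<open>C\<^sup>2\<^sub>l\<^sub>o\<^sub>c(S)\<close>, for open \<open>S\<close>: locally uniform convergence of the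
  functions and of all their partial derivatives of order one and two.\<close>

definition C2_loc_limit ::
  "'a::euclidean_space set \<Rightarrow> ('t \<Rightarrow> 'a \<Rightarrow> real) \<Rightarrow> ('a \<Rightarrow> real) \<Rightarrow> 't filter \<Rightarrow> bool" where
  "C2_loc_limit S u v F \<longleftrightarrow>
     C2_on S v \<and>
     (\<forall>K. compact K \<and> K \<subseteq> S \<longrightarrow>
        uniform_limit K u v F \<and>
        (\<forall>b\<in>Basis. uniform_limit K (\<lambda>t. partial b (u t)) (partial b v) F) \<and>
        (\<forall>a\<in>Basis. \<forall>b\<in>Basis.
           uniform_limit K (\<lambda>t. partial a (partial b (u t))) (partial a (partial b v)) F))"

definition C2_holder_bound :: "real \<Rightarrow> real \<Rightarrow> ('a::euclidean_space \<Rightarrow> real) \<Rightarrow> bool" where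
  "C2_holder_bound \<alpha> K \<psi> \<longleftrightarrow>
     C2_on UNIV \<psi> \<and>
     (\<forall>x. \<bar>\<psi> x\<bar> \<le> K) \<and>
     (\<forall>b\<in>Basis. \<forall>x. \<bar>partial b \<psi> x\<bar> \<le> K) \<and>
     (\<forall>a\<in>Basis. \<forall>b\<in>Basis. \<forall>x. \<bar>partial a (partial b \<psi>) x\<bar> \<le> K) \<and>
     (\<forall>a\<in>Basis. \<forall>b\<in>Basis. \<forall>x y.
        \<bar>partial a (partial b \<psi>) x - partial a (partial b \<psi>) y\<bar> \<le> K * dist x y powr \<alpha>)"

text \<open>Around every boundary point \<open>x\<^sub>0\<close> and after a rigid motion, the domain is the region on
  one side of a graph; the radius \<open>\<rho>\<close> and the bound \<open>K\<close> do not depend on \<open>x\<^sub>0\<close>. That the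
  graph function is defined and bounded on the whole hyperplane is no restriction, as a function
  controlled on a fixed ball can be cut off.\<close>

definition uniformly_C2_holder_domain ::
  "real \<Rightarrow> (real \<times> 'b::euclidean_space) set \<Rightarrow> bool" where
  "uniformly_C2_holder_domain \<alpha> \<Omega> \<longleftrightarrow>
     open \<Omega> \<and> connected \<Omega> \<and> \<Omega> \<noteq> {} \<and>
     (\<exists>\<rho>>0. \<exists>K. \<forall>x\<^sub>0\<in>frontier \<Omega>. \<exists>(T :: real \<times> 'b \<Rightarrow> real \<times> 'b) \<psi>.
        orthogonal_transformation T \<and> \<psi> 0 = 0 \<and> C2_holder_bound \<alpha> K \<psi> \<and>
        \<Omega> \<inter> ball x\<^sub>0 \<rho> =
          {x \<in> ball x\<^sub>0 \<rho>. fst (T (x - x\<^sub>0)) < \<psi> (snd (T (x - x\<^sub>0)))})"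

definition is_outward_normal :: "'a::euclidean_space set \<Rightarrow> 'a \<Rightarrow> 'a \<Rightarrow> bool" where
  "is_outward_normal \<Omega> x \<nu> \<longleftrightarrow>
     (\<exists>U g G. open U \<and> x \<in> U \<and>
        (\<forall>y\<in>U. GDERIV g y :> G y) \<and> continuous_on U G \<and>
        g x = 0 \<and> G x \<noteq> 0 \<and> \<Omega> \<inter> U = {y \<in> U. g y < 0} \<and>
        \<nu> = G x /\<^sub>R norm (G x))"

definition outward_normal :: "'a::euclidean_space set \<Rightarrow> 'a \<Rightarrow> 'a" where
  "outward_normal \<Omega> x = (THE \<nu>. is_outward_normal \<Omega> x \<nu>)"

text \<open>The definite description is meaningful: the normal is unique whenever it exists, and it
  exists at every boundary point of a uniformly smooth domain.\<close>

lemma is_outward_normal_unique: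
  assumes "is_outward_normal \<Omega> x \<nu>" "is_outward_normal \<Omega> x \<mu>"
  shows "\<nu> = \<mu>"
proof (rule ccontr)
  assume ne: "\<nu> \<noteq> \<mu>"
  obtain U g G where g: "open U" "x \<in> U" "GDERIV g x :> G" "g x = 0" "G \<noteq> 0"
    "\<Omega> \<inter> U = {y \<in> U. g y < 0}" "\<nu> = G /\<^sub>R norm G"
    using assms(1) unfolding is_outward_normal_def by metis
  obtain V h H where h: "open V" "x \<in> V" "GDERIV h x :> H" "h x = 0" "H \<noteq> 0"
    "\<Omega> \<inter> V = {y \<in> V. h y < 0}" "\<mu> = H /\<^sub>R norm H"
    using assms(2) unfolding is_outward_normal_def by metis
  define w where "w = \<mu> - \<nu>"
  have n: "norm \<nu> = 1" "norm \<mu> = 1" using g h by auto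
  have *: "0 < norm (\<mu> - \<nu>) ^ 2" using ne by auto
  have sq: "norm (\<mu> - \<nu>) ^ 2 = 2 - 2 * (\<mu> \<bullet> \<nu>)"
    using n by (simp add: power2_norm_eq_inner inner_diff inner_commute norm_eq_1)
  have "w \<bullet> \<nu> < 0" "w \<bullet> \<mu> > 0"
    using n * sq by (simp_all add: w_def inner_diff inner_commute norm_eq_1)
  then have wG: "w \<bullet> G < 0" and wH: "w \<bullet> H > 0"
    using g(5,7) h(5,7) by (auto simp: divide_less_0_iff zero_less_divide_iff
        mult_less_0_iff zero_less_mult_iff)
  have line: "((\<lambda>s. x + s *\<^sub>R w) has_derivative (\<lambda>s. s *\<^sub>R w)) (at 0)"
    by (auto intro!: derivative_eq_intros)
  have "(g \<circ> (\<lambda>s. x + s *\<^sub>R w) has_derivative (\<lambda>k. k \<bullet> G) \<circ> (\<lambda>s. s *\<^sub>R w)) (at 0)"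
    using g(3) by (intro diff_chain_at line) (simp add: gderiv_def)
  then have dg: "DERIV (\<lambda>s. g (x + s *\<^sub>R w)) 0 :> w \<bullet> G"
    by (simp add: has_field_derivative_def o_def mult_commute_abs)
  have "(h \<circ> (\<lambda>s. x + s *\<^sub>R w) has_derivative (\<lambda>k. k \<bullet> H) \<circ> (\<lambda>s. s *\<^sub>R w)) (at 0)"
    using h(3) by (intro diff_chain_at line) (simp add: gderiv_def)
  then have dh: "DERIV (\<lambda>s. h (x + s *\<^sub>R w)) 0 :> w \<bullet> H"
    by (simp add: has_field_derivative_def o_def mult_commute_abs)
  obtain d1 where d1: "d1 > 0" "\<And>s. 0 < s \<Longrightarrow> s < d1 \<Longrightarrow> g (x + s *\<^sub>R w) < 0"
    using DERIV_neg_dec_right[OF dg wG] g(4) by auto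
  obtain d2 where d2: "d2 > 0" "\<And>s. 0 < s \<Longrightarrow> s < d2 \<Longrightarrow> h (x + s *\<^sub>R w) > 0"
    using DERIV_pos_inc_right[OF dh wH] h(4) by auto
  have "((\<lambda>s. x + s *\<^sub>R w) \<longlongrightarrow> x + 0 *\<^sub>R w) (at_right 0)"
    by (intro tendsto_intros)
  then have "eventually (\<lambda>s. x + s *\<^sub>R w \<in> U \<inter> V) (at_right 0)"
    using g(1,2) h(1,2) by (intro topological_tendstoD) auto
  moreover have "eventually (\<lambda>s. s \<in> {0<..<min d1 d2}) (at_right (0::real))"
    using d1(1) d2(1) by (intro eventually_at_right_real) auto
  ultimately have "eventually (\<lambda>s. False) (at_right (0::real))"
  proof eventually_elim
    case (elim s)
    then have s: "0 < s" "s < d1" "s < d2" "x + s *\<^sub>R w \<in> U" "x + s *\<^sub>R w \<in> V"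
      by simp_all
    have "x + s *\<^sub>R w \<in> \<Omega> \<inter> U"
      unfolding g(6) using d1(2)[OF s(1,2)] s(4) by simp
    moreover have "x + s *\<^sub>R w \<notin> \<Omega> \<inter> V"
      unfolding h(6) using d2(2)[OF s(1,3)] by simp
    ultimately show False using s(5) by blast
  qed
  then show False by (simp add: eventually_False)
qed

lemma outward_normal_eq: "is_outward_normal \<Omega> x \<nu> \<Longrightarrow> outward_normal \<Omega> x = \<nu>"
  unfolding outward_normal_def by (rule the_equality) (auto dest: is_outward_normal_unique)

lemma is_outward_normal_outward_normal:
  fixes \<Omega> :: "(real \<times> 'b::euclidean_space) set"
  assumes dom: "uniformly_C2_holder_domain \<alpha> \<Omega>" and x: "x\<^sub>0 \<in> frontier \<Omega>"
  shows "is_outward_normal \<Omega> x\<^sub>0 (outward_normal \<Omega> x\<^sub>0)"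
proof -
  obtain \<rho> K and T :: "real \<times> 'b \<Rightarrow> real \<times> 'b" and \<psi>
    where \<rho>: "\<rho> > 0" and T: "orthogonal_transformation T" and "\<psi> 0 = 0"
    and \<psi>: "C2_holder_bound \<alpha> K \<psi>"
    and \<Omega>: "\<Omega> \<inter> ball x\<^sub>0 \<rho> =
          {x \<in> ball x\<^sub>0 \<rho>. fst (T (x - x\<^sub>0)) < \<psi> (snd (T (x - x\<^sub>0)))}"
    using dom x unfolding uniformly_C2_holder_domain_def by blast
  define g where "g y = fst (T (y - x\<^sub>0)) - \<psi> (snd (T (y - x\<^sub>0)))" for y
  define D where "D z = (\<Sum>b\<in>Basis. partial b \<psi> z *\<^sub>R b)" for z
  define G where "G y = (\<Sum>b\<in>Basis. (fst (T b) - snd (T b) \<bullet> D (snd (T (y - x\<^sub>0)))) *\<^sub>R b)" for y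
  have linT: "bounded_linear T"
    using T by (simp add: orthogonal_transformation_def linear_linear)
  have D: "(\<psi> has_derivative (\<lambda>h. h \<bullet> D z)) (at z)" for z
  proof -
    have d: "(\<psi> has_derivative frechet_derivative \<psi> (at z)) (at z)"
      using \<psi> by (simp add: C2_holder_bound_def C2_on_def frechet_derivative_works[symmetric])
    have "frechet_derivative \<psi> (at z) h = h \<bullet> D z" for h
    proof -
      interpret l: bounded_linear "frechet_derivative \<psi> (at z)"
        using d by (rule has_derivative_bounded_linear)
      have "frechet_derivative \<psi> (at z) (\<Sum>b\<in>Basis. (h \<bullet> b) *\<^sub>R b) = h \<bullet> D z"
        by (simp add: l.sum l.scale D_def inner_sum_right partial_def mult.commute)
      then show ?thesis by (simp add: euclidean_representation)
    qed
    then have "frechet_derivative \<psi> (at z) = (\<lambda>h. h \<bullet> D z)" by (rule ext)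
    then show ?thesis using d by simp
  qed
  have cD: "continuous_on UNIV D"
    unfolding D_def
  proof (intro continuous_on_sum continuous_on_scaleR continuous_on_const)
    fix b :: 'b assume "b \<in> Basis"
    then show "continuous_on UNIV (partial b \<psi>)"
      using \<psi> by (intro differentiable_imp_continuous_on)
        (auto simp: C2_holder_bound_def C2_on_def differentiable_on_def)
  qed
  have G: "h \<bullet> G y = fst (T h) - snd (T h) \<bullet> D (snd (T (y - x\<^sub>0)))" for h y
  proof -
    define l where "l h = fst (T h) - snd (T h) \<bullet> D (snd (T (y - x\<^sub>0)))" for h
    have "bounded_linear l"
      unfolding l_def
      by (intro bounded_linear_sub bounded_linear_compose[OF bounded_linear_fst linT]
          bounded_linear_compose[OF bounded_linear_inner_left]
          bounded_linear_compose[OF bounded_linear_snd linT])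
    then interpret l: bounded_linear l .
    have "l (\<Sum>b\<in>Basis. (h \<bullet> b) *\<^sub>R b) = h \<bullet> G y"
      by (simp only: l.sum l.scale) (simp add: G_def l_def inner_sum_right mult.commute)
    then show ?thesis by (simp add: euclidean_representation l_def)
  qed
  have "GDERIV g y :> G y" for y
  proof -
    have T': "((\<lambda>y. T (y - x\<^sub>0)) has_derivative T) (at y)"
      by (rule bounded_linear.has_derivative[OF linT, of "\<lambda>y. y - x\<^sub>0" "\<lambda>h. h"])
        (auto intro!: derivative_eq_intros)
    have "(\<psi> \<circ> (\<lambda>y. snd (T (y - x\<^sub>0))) has_derivative
        (\<lambda>h. h \<bullet> D (snd (T (y - x\<^sub>0)))) \<circ> (\<lambda>h. snd (T h))) (at y)"
      by (intro diff_chain_at D has_derivative_snd T')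
    then have "(g has_derivative (\<lambda>h. fst (T h) - snd (T h) \<bullet> D (snd (T (y - x\<^sub>0))))) (at y)"
      unfolding g_def by (intro has_derivative_diff has_derivative_fst T') (simp add: o_def)
    then show ?thesis by (simp add: gderiv_def G)
  qed
  moreover have "continuous_on (ball x\<^sub>0 \<rho>) G"
  proof -
    have "continuous_on (ball x\<^sub>0 \<rho>) (\<lambda>y. D (snd (T (y - x\<^sub>0))))"
      by (intro continuous_on_compose2[OF cD] continuous_on_snd
          bounded_linear.continuous_on[OF linT] continuous_intros) auto
    then show ?thesis unfolding G_def by (intro continuous_intros)
  qed
  moreover have "G x\<^sub>0 \<noteq> 0"
  proof
    assume "G x\<^sub>0 = 0"
    obtain h where "T h = (1, 0)"
      using orthogonal_transformation_surj[OF T] by (metis surjD)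
    then have "h \<bullet> G x\<^sub>0 = 1" by (simp add: G)
    then show False using \<open>G x\<^sub>0 = 0\<close> by simp
  qed
  moreover have "g x\<^sub>0 = 0"
    using \<open>\<psi> 0 = 0\<close> linear_0[OF bounded_linear.linear[OF linT]] by (simp add: g_def)
  moreover have "\<Omega> \<inter> ball x\<^sub>0 \<rho> = {y \<in> ball x\<^sub>0 \<rho>. g y < 0}"
    using \<Omega> by (simp add: g_def)
  ultimately have "is_outward_normal \<Omega> x\<^sub>0 (G x\<^sub>0 /\<^sub>R norm (G x\<^sub>0))"
    unfolding is_outward_normal_def using \<rho>
    by (intro exI[of _ "ball x\<^sub>0 \<rho>"] exI[of _ g] exI[of _ G]) simp
  then show ?thesis by (simp only: outward_normal_eq)
qed

section \<open>Bistable nonlinearity, travelling front, entire solution\<close>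

text \<open>Only the values of \<open>f\<close> on \<open>[0,1]\<close> matter; derivatives at the endpoints are one-sided.\<close>

definition bistable :: "(real \<Rightarrow> real) \<Rightarrow> real \<Rightarrow> bool" where
  "bistable f \<theta> \<longleftrightarrow>
     0 < \<theta> \<and> \<theta> < 1 \<and>
     (\<exists>f'. (\<forall>s\<in>{0..1}. (f has_real_derivative f' s) (at s within {0..1})) \<and>
           (\<exists>M. M-lipschitz_on {0..1} f') \<and> f' 0 < 0 \<and> f' 1 < 0) \<and>
     f 0 = 0 \<and> f \<theta> = 0 \<and> f 1 = 0 \<and>
     (\<forall>s\<in>{0<..<\<theta>}. f s < 0) \<and> (\<forall>s\<in>{\<theta><..<1}. f s > 0) \<and>
     integral {0..1} f > 0"

text \<open>The front takes its values in \<open>[0,1]\<close>, where the nonlinearity is given.\<close>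

definition travelling_front ::
  "(real \<Rightarrow> real) \<Rightarrow> real \<Rightarrow> (real \<Rightarrow> real) \<Rightarrow> real \<Rightarrow> bool" where
  "travelling_front f \<theta> \<phi> c \<longleftrightarrow>
     c > 0 \<and> (\<forall>z. \<phi> z \<in> {0..1}) \<and>
     (\<exists>\<phi>' \<phi>''. \<forall>z. (\<phi> has_real_derivative \<phi>' z) (at z) \<and>
                 (\<phi>' has_real_derivative \<phi>'' z) (at z) \<and>
                 \<phi>'' z + c * \<phi>' z + f (\<phi> z) = 0) \<and>
     (\<phi> \<longlongrightarrow> 1) at_bot \<and> (\<phi> \<longlongrightarrow> 0) at_top \<and> \<phi> 0 = \<theta>"

text \<open>Spatial gradients \<open>G\<close> exist and are continuous up to the boundary, so that the
  Neumann condition makes sense pointwise.\<close>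

definition neumann_condition ::
  "'a::euclidean_space set \<Rightarrow> (real \<Rightarrow> 'a \<Rightarrow> real) \<Rightarrow> bool" where
  "neumann_condition \<Omega> u \<longleftrightarrow>
     (\<exists>G. (\<forall>t. \<forall>x\<in>closure \<Omega>. (u t has_derivative (\<lambda>h. h \<bullet> G t x)) (at x within closure \<Omega>)) \<and>
          continuous_on (UNIV \<times> closure \<Omega>) (\<lambda>(t, x). G t x) \<and>
          (\<forall>t. \<forall>x\<in>frontier \<Omega>. G t x \<bullet> outward_normal \<Omega> x = 0))"

text \<open>Classical solutions of \<open>\<partial>\<^sub>t u - \<Delta> u = f(u)\<close> in \<open>\<real> \<times> \<Omega>\<close>, \<open>\<partial>\<^sub>\<nu> u = 0\<close> on the boundary.\<close>

definition entire_solution ::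
  "(real \<Rightarrow> real) \<Rightarrow> 'a::euclidean_space set \<Rightarrow> (real \<Rightarrow> 'a \<Rightarrow> real) \<Rightarrow> bool" where
  "entire_solution f \<Omega> u \<longleftrightarrow>
     continuous_on (UNIV \<times> closure \<Omega>) (\<lambda>(t, x). u t x) \<and>
     (\<forall>t. C2_on \<Omega> (u t)) \<and>
     (\<forall>a\<in>Basis. \<forall>b\<in>Basis.
        continuous_on (UNIV \<times> \<Omega>) (\<lambda>(t, x). partial a (partial b (u t)) x)) \<and>
     (\<forall>t. \<forall>x\<in>\<Omega>. (\<lambda>s. u s x) differentiable (at t)) \<and>
     continuous_on (UNIV \<times> \<Omega>) (\<lambda>(t, x). deriv (\<lambda>s. u s x) t) \<and>
     (\<forall>t. \<forall>x\<in>\<Omega>. deriv (\<lambda>s. u s x) t - laplacian (u t) x = f (u t x)) \<and>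
     neumann_condition \<Omega> u"

definition stationary_solution ::
  "(real \<Rightarrow> real) \<Rightarrow> 'a::euclidean_space set \<Rightarrow> ('a \<Rightarrow> real) \<Rightarrow> bool" where
  "stationary_solution f \<Omega> v \<longleftrightarrow> entire_solution f \<Omega> (\<lambda>_. v)"

text \<open>The entire solution emanating from the front, together with its large time limit \<open>v\<close>.
  Such a \<open>u\<close> is unique; monotonicity in time, existence of the limit and its being stationary
  are known properties of that solution.\<close>

definition front_solution ::
  "(real \<Rightarrow> real) \<Rightarrow> (real \<Rightarrow> real) \<Rightarrow> real \<Rightarrow> (real \<times> 'b::euclidean_space) set \<Rightarrow>
   (real \<Rightarrow> real \<times> 'b \<Rightarrow> real) \<Rightarrow> (real \<times> 'b \<Rightarrow> real) \<Rightarrow> bool" where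
  "front_solution f \<phi> c \<Omega> u v \<longleftrightarrow>
     entire_solution f \<Omega> u \<and>
     (\<forall>t. \<forall>x\<in>\<Omega>. 0 < u t x \<and> u t x < 1) \<and>
     uniform_limit (closure \<Omega>) (\<lambda>t x. u t x - \<phi> (fst x - c * t)) (\<lambda>_. 0) at_bot \<and>
     (\<forall>x\<in>\<Omega>. mono (\<lambda>t. u t x)) \<and>
     C2_loc_limit \<Omega> u v at_top \<and>
     stationary_solution f \<Omega> v"

end

theory Submission
  imports Defs
begin

text \<open>The large time limit \<open>v\<close> of the solution is a stationary Neumann solution, and the proof is an
elliptic sliding argument for \<open>v\<close>. From the evolution one keeps only that \<open>0 \<le> v \<le> 1\<close> and that \<open>v\<close> lies
above every \<open>u t\<close>; since \<open>u t\<close> resembles the front for very negative \<open>t\<close>, this gives \<open>v \<rightarrow> 1\<close> as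
\<open>x\<^sub>1 \<rightarrow> -\<infinity>\<close>, uniformly in the domain (\<open>front_limit_properties\<close>). In this outline \<open>F\<close> is \<open>f\<close> continued by
constants outside \<open>[0,1]\<close>, and \<open>N\<close> is the dimension.

\<^bold>\<open>No contact.\<close> Suppose \<open>w\<close> touches \<open>v\<close> from below at a point where \<open>\<Delta>w + F(w) > 0\<close>, and \<open>\<partial>\<^sub>\<nu>w \<le> 0\<close> on
the boundary nearby. Then \<open>v - w\<close> has a minimum, near which its Laplacian is negative and at whose
boundary points its normal derivative is nonnegative. The second derivative test excludes this in
the interior, and a Hopf type perturbation (\<open>no_boundary_minimum\<close>) excludes it on the boundary. Hence a
continuous family of such functions that starts strictly below \<open>v\<close> remains strictly below (\<open>sliding\<close>).

\<^bold>\<open>The subsolutions.\<close> As the integral of \<open>f\<close> is positive, there are \<open>m\<^sub>1 > \<theta>\<close> and \<open>\<kappa> > 0\<close> such that the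
solution of \<open>h'' + F(h) = \<kappa>\<close>, \<open>h 0 = m\<^sub>1\<close>, \<open>h' 0 = -p\<close> with \<open>p > 0\<close> small decreases to the value \<open>0\<close> within a
finite length \<open>\<rho>\<close>: its energy shows that the slope cannot vanish on the way (\<open>bistable_profile\<close>). A flat
paraboloid of height \<open>m > m\<^sub>1\<close> and radius \<open>r\<^sub>1\<close>, continued by \<open>h(\<bar>x\<bar> - r\<^sub>1)\<close>, is the function \<open>bump\<close>; it is
positive in the ball of radius \<open>r\<^sub>1 + \<rho>\<close>, which is the radius asserted in the theorem. If \<open>r\<^sub>1\<close> is large, the
curvature term \<open>(N - 1) h' / \<bar>x\<bar>\<close> is absorbed by \<open>\<kappa>\<close>. The same \<open>h\<close> with an exponential cap gives the
planar function \<open>ramp\<close>, which increases in \<open>x\<^sub>1\<close> towards \<open>m\<close>.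

\<^bold>\<open>Sliding.\<close> The bump starts far to the left, where \<open>v > m\<close>, and moves right along the axis; there its
positive part stays inside the straight cylinder and sees no boundary. Once its centre \<open>c\<close> has
\<open>c\<^sub>1 > L + r\<^sub>1 + \<rho>\<close>, it may be moved to any other such point of the domain inside the convex part:
convexity gives \<open>(x - c) \<bullet> \<nu>(x) \<ge> 0\<close> (\<open>convex_outward_normal\<close>), so the radially decreasing bump has
\<open>\<partial>\<^sub>\<nu> \<le> 0\<close>. Therefore \<open>v > m\<close> for \<open>x\<^sub>1 > L + r\<^sub>1 + \<rho>\<close>. The ramp is now moved from the right to the left; by
\<open>\<nu>\<^sub>1 \<le> 0\<close> its normal derivative has the good sign, and contact could only occur in a bounded region.
Hence \<open>v \<ge> m\<close> everywhere.

\<^bold>\<open>Conclusion.\<close> Let \<open>\<mu> = inf v\<close>, so that \<open>\<theta> < m \<le> \<mu>\<close>, and suppose \<open>\<mu> < 1\<close>. In the convex part, a minimum of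
\<open>v + d \<bar>x - y\<bar>\<^sup>2\<close> with small \<open>d\<close> contradicts \<open>F > 0\<close> near \<open>\<mu>\<close>, so \<open>v\<close> stays away from \<open>\<mu>\<close> there by a fixed amount.
Far to the left \<open>v\<close> is close to \<open>1\<close>. So \<open>\<mu>\<close> is attained in the bounded remaining region, where
\<open>\<Delta>v = -F(v) < 0\<close> contradicts minimality.\<close>

section \<open>Second derivatives along lines\<close>

text \<open>The second derivative at \<open>x\<close> in direction \<open>b\<close>, stated along the line only. A solution, a composition with
a graph function in rotated coordinates, and a radial test function can then be added without any
chain rule for second derivatives in several variables.\<close>

definition line_deriv2 :: "('a::real_normed_vector \<Rightarrow> real) \<Rightarrow> 'a \<Rightarrow> 'a \<Rightarrow> real \<Rightarrow> bool" where
  "line_deriv2 w x b D \<longleftrightarrow> (\<exists>w'.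
     (\<forall>\<^sub>F t in nhds 0. ((\<lambda>t. w (x + t *\<^sub>R b)) has_real_derivative w' t) (at t)) \<and>
     (w' has_real_derivative D) (at 0))"

lemma line_deriv2I:
  assumes "\<forall>\<^sub>F t in nhds 0. ((\<lambda>t. w (x + t *\<^sub>R b)) has_real_derivative w' t) (at t)"
    and "(w' has_real_derivative D) (at 0)"
  shows "line_deriv2 w x b D"
  using assms unfolding line_deriv2_def by blast

lemma line_deriv2_add:
  assumes "line_deriv2 v x b D" "line_deriv2 w x b E"
  shows "line_deriv2 (\<lambda>x. v x + w x) x b (D + E)"
proof -
  obtain v' where v': "\<forall>\<^sub>F t in nhds 0. ((\<lambda>t. v (x + t *\<^sub>R b)) has_real_derivative v' t) (at t)"
    "(v' has_real_derivative D) (at 0)" using assms(1) unfolding line_deriv2_def by blast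
  obtain w' where w': "\<forall>\<^sub>F t in nhds 0. ((\<lambda>t. w (x + t *\<^sub>R b)) has_real_derivative w' t) (at t)"
    "(w' has_real_derivative E) (at 0)" using assms(2) unfolding line_deriv2_def by blast
  show ?thesis
  proof (rule line_deriv2I)
    show "\<forall>\<^sub>F t in nhds 0. ((\<lambda>t. v (x + t *\<^sub>R b) + w (x + t *\<^sub>R b)) has_real_derivative (v' t + w' t)) (at t)"
      using v'(1) w'(1) by eventually_elim (rule DERIV_add)
    show "((\<lambda>t. v' t + w' t) has_real_derivative D + E) (at 0)"
      using v'(2) w'(2) by (rule DERIV_add)
  qed
qed

lemma line_deriv2_cmult:
  assumes "line_deriv2 v x b D"
  shows "line_deriv2 (\<lambda>x. c * v x) x b (c * D)"
proof -
  obtain v' where v': "\<forall>\<^sub>F t in nhds 0. ((\<lambda>t. v (x + t *\<^sub>R b)) has_real_derivative v' t) (at t)"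
    "(v' has_real_derivative D) (at 0)" using assms(1) unfolding line_deriv2_def by blast
  show ?thesis
  proof (rule line_deriv2I)
    show "\<forall>\<^sub>F t in nhds 0. ((\<lambda>t. c * v (x + t *\<^sub>R b)) has_real_derivative (c * v' t)) (at t)"
      using v'(1) by eventually_elim (rule DERIV_cmult)
    show "((\<lambda>t. c * v' t) has_real_derivative c * D) (at 0)"
      using v'(2) by (rule DERIV_cmult)
  qed
qed

lemma line_deriv2_diff:
  assumes "line_deriv2 v x b D" "line_deriv2 w x b E"
  shows "line_deriv2 (\<lambda>x. v x - w x) x b (D - E)"
  using line_deriv2_add[OF assms(1) line_deriv2_cmult[OF assms(2), of "-1"]] by simp

lemma line_deriv2_nonneg_at_minimum:
  assumes D: "line_deriv2 w x b D" and min: "\<forall>\<^sub>F t in nhds 0. w x \<le> w (x + t *\<^sub>R b)"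
  shows "D \<ge> 0"
proof (rule ccontr)
  assume "\<not> D \<ge> 0"
  then have D0: "D < 0" by simp
  obtain w' where w': "\<forall>\<^sub>F t in nhds 0. ((\<lambda>t. w (x + t *\<^sub>R b)) has_real_derivative w' t) (at t)"
    "(w' has_real_derivative D) (at 0)" using D unfolding line_deriv2_def by blast
  obtain e where e: "e > 0"
    and der: "\<And>t. \<bar>t\<bar> < e \<Longrightarrow> ((\<lambda>t. w (x + t *\<^sub>R b)) has_real_derivative w' t) (at t)"
    and le: "\<And>t. \<bar>t\<bar> < e \<Longrightarrow> w x \<le> w (x + t *\<^sub>R b)"
    using eventually_conj[OF w'(1) min] unfolding eventually_nhds_metric dist_real_def by auto
  have "w' 0 = 0"
    by (rule DERIV_local_min[OF der[of 0] e]) (use le e in auto)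
  moreover obtain d where d: "d > 0" "\<And>h. 0 < h \<Longrightarrow> h < d \<Longrightarrow> w' (0 + h) < w' 0"
    using DERIV_neg_dec_right[OF w'(2) D0] by auto
  ultimately have neg: "0 < h \<Longrightarrow> h < d \<Longrightarrow> w' h < 0" for h by simp
  define t where "t = min d e / 2"
  have t: "0 < t" "t < d" "t < e" using d e by (auto simp: t_def)
  obtain z where z: "0 < z" "z < t" "w (x + t *\<^sub>R b) - w (x + 0 *\<^sub>R b) = (t - 0) * w' z"
    using MVT2[of 0 t "\<lambda>t. w (x + t *\<^sub>R b)" w'] t der by auto
  have "w' z < 0" using neg z t by auto
  then have "t * w' z < 0" using t by (intro mult_pos_neg)
  with z t le[of t] show False by auto
qed

lemma DERIV_along_line:
  assumes "(v has_derivative v') (at (x + t *\<^sub>R k))"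
  shows "((\<lambda>t. v (x + t *\<^sub>R k)) has_real_derivative v' k) (at t)"
proof -
  have "((\<lambda>s. x + s *\<^sub>R k) has_derivative (\<lambda>s. s *\<^sub>R k)) (at t)"
    by (auto intro!: derivative_eq_intros)
  then have "(v \<circ> (\<lambda>s. x + s *\<^sub>R k) has_derivative v' \<circ> (\<lambda>s. s *\<^sub>R k)) (at t)"
    using assms by (intro diff_chain_at)
  moreover have "v' (s *\<^sub>R k) = v' k * s" for s
    using linear_scale[OF has_derivative_linear[OF assms]] by simp
  ultimately show ?thesis
    by (simp add: has_field_derivative_def o_def)
qed

lemma frechet_derivative_eq_partials:
  assumes "v differentiable (at x)"
  shows "frechet_derivative v (at x) k = (\<Sum>b\<in>Basis. (k \<bullet> b) * partial b v x)"
proof -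
  have "linear (frechet_derivative v (at x))"
    using assms frechet_derivative_works has_derivative_linear by blast
  then have "frechet_derivative v (at x) (\<Sum>b\<in>Basis. (k \<bullet> b) *\<^sub>R b)
      = (\<Sum>b\<in>Basis. (k \<bullet> b) * partial b v x)"
    by (simp add: linear_sum linear_scale partial_def)
  then show ?thesis by (simp add: euclidean_representation)
qed

lemma DERIV_along_line_partials:
  assumes "v differentiable (at (x + t *\<^sub>R k))"
  shows "((\<lambda>t. v (x + t *\<^sub>R k)) has_real_derivative
    (\<Sum>b\<in>Basis. (k \<bullet> b) * partial b v (x + t *\<^sub>R k))) (at t)"
  using DERIV_along_line[of v _ x t k] assms
  by (metis frechet_derivative_eq_partials frechet_derivative_works)

lemma eventually_along_line:
  fixes x b :: "'a::real_normed_vector"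
  assumes "open S" "x \<in> S"
  shows "\<forall>\<^sub>F t in nhds (0::real). x + t *\<^sub>R b \<in> S"
proof -
  have "((\<lambda>t. x + t *\<^sub>R b) \<longlongrightarrow> x + 0 *\<^sub>R b) (nhds 0)"
    by (intro tendsto_intros filterlim_ident)
  then show ?thesis using assms by (intro topological_tendstoD) auto
qed

lemma C2_on_line_deriv2:
  assumes "C2_on S v" "open S" "x \<in> S"
  shows "line_deriv2 v x k (\<Sum>a\<in>Basis. \<Sum>b\<in>Basis. (k \<bullet> a) * (k \<bullet> b) * partial b (partial a v) x)"
proof (rule line_deriv2I)
  show "\<forall>\<^sub>F t in nhds 0. ((\<lambda>t. v (x + t *\<^sub>R k)) has_real_derivative
      (\<Sum>a\<in>Basis. (k \<bullet> a) * partial a v (x + t *\<^sub>R k))) (at t)"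
    using eventually_along_line[OF assms(2,3), of k]
    by eventually_elim (use assms(1) in \<open>auto simp: C2_on_def intro!: DERIV_along_line_partials\<close>)
  have "((\<lambda>t. partial a v (x + t *\<^sub>R k)) has_real_derivative
      (\<Sum>b\<in>Basis. (k \<bullet> b) * partial b (partial a v) (x + 0 *\<^sub>R k))) (at 0)" if "a \<in> Basis" for a
    using assms that by (intro DERIV_along_line_partials) (auto simp: C2_on_def)
  then have "((\<lambda>t. \<Sum>a\<in>Basis. (k \<bullet> a) * partial a v (x + t *\<^sub>R k)) has_real_derivative
      (\<Sum>a\<in>Basis. (k \<bullet> a) * (\<Sum>b\<in>Basis. (k \<bullet> b) * partial b (partial a v) (x + 0 *\<^sub>R k)))) (at 0)"
    by (intro DERIV_sum DERIV_cmult)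
  then show "((\<lambda>t. \<Sum>a\<in>Basis. (k \<bullet> a) * partial a v (x + t *\<^sub>R k)) has_real_derivative
      (\<Sum>a\<in>Basis. \<Sum>b\<in>Basis. (k \<bullet> a) * (k \<bullet> b) * partial b (partial a v) x)) (at 0)"
    by (simp add: sum_distrib_left mult.assoc)
qed

lemma C2_on_line_deriv2_Basis:
  assumes "C2_on S v" "open S" "x \<in> S" "b \<in> Basis"
  shows "line_deriv2 v x b (partial b (partial b v) x)"
proof -
  have "(\<Sum>a\<in>Basis. \<Sum>c\<in>Basis. (b \<bullet> a) * (b \<bullet> c) * partial c (partial a v) x)
    = (\<Sum>a\<in>Basis. \<Sum>c\<in>Basis. if a = b then (if c = b then partial b (partial b v) x else 0) else 0)"
    using assms(4) by (intro sum.cong refl) (auto simp: inner_Basis)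
  also have "\<dots> = (\<Sum>a\<in>Basis. if a = b then partial b (partial b v) x else 0)"
    using assms(4) by (intro sum.cong refl) (auto simp: sum.delta)
  also have "\<dots> = partial b (partial b v) x"
    using assms(4) by (simp add: sum.delta)
  finally show ?thesis using C2_on_line_deriv2[OF assms(1-3), of b] by simp
qed

lemma line_deriv2_norm_square:
  fixes c x :: "'a::euclidean_space"
  assumes "b \<in> Basis"
  shows "line_deriv2 (\<lambda>x. (norm (x - c))\<^sup>2) x b 2"
proof (rule line_deriv2I)
  have eq: "(norm (x + t *\<^sub>R b - c))\<^sup>2 = (norm (x - c))\<^sup>2 + 2 * t * ((x - c) \<bullet> b) + t\<^sup>2" for t
  proof -
    have "x + t *\<^sub>R b - c = (x - c) + t *\<^sub>R b" by simp
    then show ?thesis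
      using assms by (simp only: power2_norm_eq_inner)
        (simp add: inner_add_left inner_add_right inner_commute[of b "x - c"] power2_eq_square distrib_left)
  qed
  show "\<forall>\<^sub>F t in nhds 0. ((\<lambda>t. (norm (x + t *\<^sub>R b - c))\<^sup>2) has_real_derivative
      2 * ((x - c) \<bullet> b) + 2 * t) (at t)"
    unfolding eq by (intro always_eventually allI) (auto intro!: derivative_eq_intros)
  show "((\<lambda>t. 2 * ((x - c) \<bullet> b) + 2 * t) has_real_derivative 2) (at 0)"
    by (auto intro!: derivative_eq_intros)
qed

section \<open>A boundary minimum principle\<close>

text \<open>The chart of the domain around a boundary point, turned into a defining function \<open>g\<close>. Two features matter
later: the gradient has length at least \<open>1\<close>, because in the vertical direction of the chart \<open>g\<close> has
slope \<open>1\<close>, and the second derivatives along the axes are bounded above, because those of the graph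
function are bounded. The chart at \<open>x0\<close> also computes the normals at the neighbouring boundary points.\<close>

lemma local_defining_function:
  fixes \<Omega> :: "(real \<times> 'b::euclidean_space) set"
  assumes dom: "uniformly_C2_holder_domain \<alpha> \<Omega>" and x0: "x0 \<in> frontier \<Omega>"
  obtains \<rho> M g G where "\<rho> > 0" "g x0 = 0" "\<And>y. GDERIV g y :> G y" "\<And>y. norm (G y) \<ge> 1"
    "\<Omega> \<inter> ball x0 \<rho> = {y \<in> ball x0 \<rho>. g y < 0}"
    "\<And>y. y \<in> frontier \<Omega> \<Longrightarrow> y \<in> ball x0 \<rho> \<Longrightarrow> g y = 0 \<and> outward_normal \<Omega> y = G y /\<^sub>R norm (G y)"
    "\<And>y b. b \<in> Basis \<Longrightarrow> \<exists>D\<le>M. line_deriv2 g y b D"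
proof -
  obtain \<rho> K and T :: "real \<times> 'b \<Rightarrow> real \<times> 'b" and \<psi>
    where \<rho>: "\<rho> > 0" and T: "orthogonal_transformation T" and \<psi>0: "\<psi> 0 = 0"
    and \<psi>: "C2_holder_bound \<alpha> K \<psi>"
    and \<Omega>: "\<Omega> \<inter> ball x0 \<rho> =
          {x \<in> ball x0 \<rho>. fst (T (x - x0)) < \<psi> (snd (T (x - x0)))}"
    using dom x0 unfolding uniformly_C2_holder_domain_def by blast
  have opn: "open \<Omega>" using dom by (simp add: uniformly_C2_holder_domain_def)
  define g where "g y = fst (T (y - x0)) - \<psi> (snd (T (y - x0)))" for y
  define D where "D z = (\<Sum>b\<in>Basis. partial b \<psi> z *\<^sub>R b)" for z
  define e where "e = inv T (1, 0)"
  have e: "T e = (1, 0)"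
    unfolding e_def using orthogonal_transformation_surj[OF T] by (rule surj_f_inv_f)
  have ne: "norm e = 1"
    using orthogonal_transformation_norm[OF T, of e] by (simp add: e norm_prod_def)
  have linT: "linear T" using T by (simp add: orthogonal_transformation_def)
  then have blT: "bounded_linear T" by (simp add: linear_linear)
  have diff\<psi>: "\<psi> differentiable (at z)" for z
    using \<psi> by (simp add: C2_holder_bound_def C2_on_def)
  have D: "(\<psi> has_derivative (\<lambda>h. h \<bullet> D z)) (at z)" for z
  proof -
    have "frechet_derivative \<psi> (at z) = (\<lambda>h. h \<bullet> D z)"
      by (rule ext, subst frechet_derivative_eq_partials[OF diff\<psi>])
        (simp add: D_def inner_sum_right mult.commute)
    then show ?thesis using diff\<psi>[of z] frechet_derivative_works by metis
  qed
  have cD: "continuous_on UNIV D"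
    unfolding D_def
  proof (intro continuous_on_sum continuous_on_scaleR continuous_on_const)
    fix b :: 'b assume "b \<in> Basis"
    then show "continuous_on UNIV (partial b \<psi>)"
      using \<psi> by (intro differentiable_imp_continuous_on)
        (auto simp: C2_holder_bound_def C2_on_def differentiable_on_def)
  qed
  \<comment> \<open>The inverse of an orthogonal map is its adjoint, which turns the chain rule into a gradient.\<close>
  define G where "G y = adjoint T (1, - D (snd (T (y - x0))))" for y
  have G: "h \<bullet> G y = fst (T h) - snd (T h) \<bullet> D (snd (T (y - x0)))" for h y
    unfolding G_def adjoint_works[OF linT] by (simp add: inner_prod_def)
  have gd: "GDERIV g y :> G y" for y
  proof -
    have T': "((\<lambda>y. T (y - x0)) has_derivative T) (at y)"
      by (rule bounded_linear.has_derivative[OF blT, of "\<lambda>y. y - x0" "\<lambda>h. h"])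
        (auto intro!: derivative_eq_intros)
    have "(\<psi> \<circ> (\<lambda>y. snd (T (y - x0))) has_derivative
        (\<lambda>h. h \<bullet> D (snd (T (y - x0)))) \<circ> (\<lambda>h. snd (T h))) (at y)"
      by (intro diff_chain_at D has_derivative_snd T')
    then have "(g has_derivative (\<lambda>h. fst (T h) - snd (T h) \<bullet> D (snd (T (y - x0))))) (at y)"
      unfolding g_def by (intro has_derivative_diff has_derivative_fst T') (simp add: o_def)
    then show ?thesis by (simp add: gderiv_def G)
  qed
  have cG: "continuous_on (ball x0 \<rho>) G"
  proof -
    have "bounded_linear (adjoint T)" using adjoint_linear[OF linT] by (simp add: linear_linear)
    moreover have "continuous_on (ball x0 \<rho>) (\<lambda>y. (1 :: real, - D (snd (T (y - x0)))))"
      by (intro continuous_on_Pair continuous_on_const continuous_on_minus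
          continuous_on_compose2[OF cD] continuous_on_snd
          bounded_linear.continuous_on[OF blT] continuous_intros) auto
    ultimately show ?thesis unfolding G_def
      by (rule bounded_linear.continuous_on)
  qed
  have nG: "norm (G y) \<ge> 1" for y
    using norm_cauchy_schwarz[of e "G y"] by (simp add: G e ne)
  have gx0: "g x0 = 0" using \<psi>0 linear_0[OF linT] by (simp add: g_def)
  have \<Omega>g: "\<Omega> \<inter> ball x0 \<rho> = {y \<in> ball x0 \<rho>. g y < 0}" using \<Omega> by (simp add: g_def)
  have contg: "isCont g y" for y
    using gd[of y] unfolding gderiv_def by (rule has_derivative_continuous)
  have front: "g y = 0 \<and> outward_normal \<Omega> y = G y /\<^sub>R norm (G y)"
    if y: "y \<in> frontier \<Omega>" "y \<in> ball x0 \<rho>" for y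
  proof -
    have "y \<notin> \<Omega>" using y opn by (simp add: frontier_def interior_open)
    then have "g y \<ge> 0" using \<Omega>g y by force
    moreover have "g y \<le> 0"
    proof (rule ccontr)
      assume "\<not> g y \<le> 0"
      then have "\<forall>\<^sub>F z in nhds y. g z > 0"
        using contg[of y] by (intro order_tendstoD) (auto simp: isCont_def tendsto_at_iff_tendsto_nhds)
      moreover have "\<forall>\<^sub>F z in nhds y. z \<in> ball x0 \<rho>"
        using y by (intro eventually_nhds_in_open) auto
      ultimately have "\<forall>\<^sub>F z in nhds y. z \<notin> \<Omega>"
        by eventually_elim (use \<Omega>g in force)
      then have "y \<notin> closure \<Omega>" 
        unfolding eventually_nhds closure_iff_nhds_not_empty by blast
      then show False using y by (simp add: frontier_def)
    qed
    ultimately have "g y = 0" by simp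
    moreover have "G y \<noteq> 0" using nG[of y] by auto
    ultimately have "is_outward_normal \<Omega> y (G y /\<^sub>R norm (G y))"
      unfolding is_outward_normal_def using \<Omega>g gd cG y
      by (intro exI[of _ "ball x0 \<rho>"] exI[of _ g] exI[of _ G]) simp
    then show ?thesis using \<open>g y = 0\<close> by (simp only: outward_normal_eq)
  qed
  define M where "M = (\<Sum>(a::'b)\<in>Basis. \<Sum>(b::'b)\<in>Basis. K)"
  have "\<exists>D\<le>M. line_deriv2 g y b D" if b: "b \<in> Basis" for y b
  proof -
    define k where "k = snd (T b)"
    define z where "z = snd (T (y - x0))"
    define E where "E = (\<Sum>a\<in>Basis. \<Sum>b\<in>Basis. (k \<bullet> a) * (k \<bullet> b) * partial b (partial a \<psi>) z)"
    have "line_deriv2 \<psi> z k E"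
      unfolding E_def by (rule C2_on_line_deriv2[of UNIV])
        (use \<psi> in \<open>auto simp: C2_holder_bound_def\<close>)
    then obtain w' where w': "\<forall>\<^sub>F t in nhds 0. ((\<lambda>t. \<psi> (z + t *\<^sub>R k)) has_real_derivative w' t) (at t)"
        "(w' has_real_derivative E) (at 0)"
      unfolding line_deriv2_def by blast
    have eq: "g (y + t *\<^sub>R b) = fst (T (y - x0)) + t * fst (T b) - \<psi> (z + t *\<^sub>R k)" for t
    proof -
      have "T (y + t *\<^sub>R b - x0) = T (y - x0) + t *\<^sub>R T b"
        using linear_add[OF linT, of "y - x0" "t *\<^sub>R b"] linear_scale[OF linT, of t b]
        by (simp add: algebra_simps)
      then show ?thesis by (simp add: g_def z_def k_def)
    qed
    have "line_deriv2 g y b (- E)"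
    proof (rule line_deriv2I)
      show "\<forall>\<^sub>F t in nhds 0. ((\<lambda>t. g (y + t *\<^sub>R b)) has_real_derivative fst (T b) - w' t) (at t)"
        unfolding eq using w'(1)
        by eventually_elim (auto intro!: derivative_eq_intros)
      show "((\<lambda>t. fst (T b) - w' t) has_real_derivative - E) (at 0)"
        using w'(2) by (auto intro!: derivative_eq_intros)
    qed
    moreover have "- E \<le> M"
    proof -
      have "norm k \<le> 1"
        using norm_snd_le[of "snd (T b)" "fst (T b)"] orthogonal_transformation_norm[OF T, of b] b
        by (simp add: k_def)
      then have k1: "\<bar>k \<bullet> a\<bar> \<le> 1" if "a \<in> Basis" for a
        using Basis_le_norm[OF that, of k] by linarith
      have "- ((k \<bullet> a) * (k \<bullet> c) * partial c (partial a \<psi>) z) \<le> K"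
        if "a \<in> Basis" "c \<in> Basis" for a c
      proof -
        have 1: "\<bar>(k \<bullet> a) * (k \<bullet> c)\<bar> \<le> 1"
          using mult_mono[OF k1[OF that(1)] k1[OF that(2)]] by (simp add: abs_mult)
        have 2: "\<bar>partial c (partial a \<psi>) z\<bar> \<le> K"
          using \<psi> that by (auto simp: C2_holder_bound_def)
        have "\<bar>(k \<bullet> a) * (k \<bullet> c) * partial c (partial a \<psi>) z\<bar> \<le> 1 * K"
          unfolding abs_mult[of "(k \<bullet> a) * (k \<bullet> c)"] by (rule mult_mono[OF 1 2]) auto
        then show ?thesis by linarith
      qed
      then show ?thesis unfolding E_def M_def sum_negf[symmetric] by (intro sum_mono) 
    qed
    ultimately show ?thesis by blast
  qed
  then show thesis using that[OF \<rho> gx0 gd nG \<Omega>g front] by blast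
qed

text \<open>A Hopf type lemma for functions with negative Laplacian. If \<open>x0\<close> is a boundary minimum, then \<open>w > w x0\<close> inside the
domain. Let \<open>g\<close> be a defining function and perturb \<open>w\<close> to
\<open>w + \<epsilon> (g + \<bar>x - x0\<bar>\<^sup>2 / (4 r))\<close> on the part \<open>g \<ge> - r / 8\<close> of a ball of radius \<open>r\<close> around \<open>x0\<close>. The quadratic
term makes the perturbation positive on the sphere; on the inner face \<open>g = - r / 8\<close> the gap of \<open>w\<close>
wins for small \<open>\<epsilon>\<close>. So the minimum is attained elsewhere: not in the interior, by the Laplacian, and
not on the boundary, where the perturbation has normal derivative at least
\<open>\<epsilon> (\<bar>\<nabla>g\<bar> - 1 / 2) > 0\<close>.\<close>

lemma no_boundary_minimum:
  fixes \<Omega> :: "(real \<times> 'b::euclidean_space) set"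
  assumes dom: "uniformly_C2_holder_domain \<alpha> \<Omega>" and x0: "x0 \<in> closure \<Omega>" and e: "e > 0" and \<kappa>: "\<kappa> > 0"
    and cont: "continuous_on (closure \<Omega> \<inter> ball x0 e) w"
    and min: "\<And>x. x \<in> closure \<Omega> \<Longrightarrow> x \<in> ball x0 e \<Longrightarrow> w x0 \<le> w x"
    and lap: "\<And>x. x \<in> \<Omega> \<Longrightarrow> x \<in> ball x0 e \<Longrightarrow>
      \<exists>D. (\<forall>b\<in>Basis. line_deriv2 w x b (D b)) \<and> (\<Sum>b\<in>Basis. D b) \<le> - \<kappa>"
    and nor: "\<And>x. x \<in> frontier \<Omega> \<Longrightarrow> x \<in> ball x0 e \<Longrightarrow>
      \<exists>\<gamma>. (w has_derivative (\<lambda>h. h \<bullet> \<gamma>)) (at x within closure \<Omega>) \<and> \<gamma> \<bullet> outward_normal \<Omega> x \<ge> 0"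
  shows False
proof -
  have opn: "open \<Omega>" using dom by (simp add: uniformly_C2_holder_domain_def)
  have cl: "x \<in> \<Omega> \<or> x \<in> frontier \<Omega>" if "x \<in> closure \<Omega>" for x
    using that opn by (auto simp: frontier_def interior_open)
  have interior: "w x > w x0" if x: "x \<in> \<Omega>" "x \<in> ball x0 e" for x
  proof (rule ccontr)
    assume "\<not> w x > w x0"
    then have eq: "w x = w x0" using min[of x] x closure_subset[of \<Omega>] by force
    obtain D where D: "\<And>b. b \<in> Basis \<Longrightarrow> line_deriv2 w x b (D b)" "(\<Sum>b\<in>Basis. D b) \<le> - \<kappa>"
      using lap[OF x] by blast
    have "D b \<ge> 0" if "b \<in> Basis" for b
    proof (rule line_deriv2_nonneg_at_minimum[OF D(1)[OF that]])
      show "\<forall>\<^sub>F t in nhds 0. w x \<le> w (x + t *\<^sub>R b)"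
        using eventually_along_line[of "\<Omega> \<inter> ball x0 e" x b, OF open_Int[OF opn open_ball] IntI[OF x]]
        by (rule eventually_mono) (auto simp: eq intro!: min closure_subset[THEN subsetD])
    qed
    then have "(\<Sum>b\<in>Basis. D b) \<ge> 0" by (rule sum_nonneg)
    with D(2) \<kappa> show False by simp
  qed
  have fr0: "x0 \<in> frontier \<Omega>"
    using interior[of x0] cl[OF x0] e by force
  obtain \<rho> M g G where \<rho>: "\<rho> > 0" and g0: "g x0 = 0" and gd: "\<And>y. GDERIV g y :> G y"
    and nG: "\<And>y. norm (G y) \<ge> 1"
    and \<Omega>g: "\<Omega> \<inter> ball x0 \<rho> = {y \<in> ball x0 \<rho>. g y < 0}"
    and fr: "\<And>y. y \<in> frontier \<Omega> \<Longrightarrow> y \<in> ball x0 \<rho> \<Longrightarrow> g y = 0 \<and> outward_normal \<Omega> y = G y /\<^sub>R norm (G y)"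
    and g2: "\<And>y b. b \<in> Basis \<Longrightarrow> \<exists>D\<le>M. line_deriv2 g y b D"
    by (rule local_defining_function[OF dom fr0]) (rule that)
  have contg: "continuous_on S g" for S
    using gd by (auto simp: gderiv_def intro!: continuous_at_imp_continuous_on has_derivative_continuous)
  define r where "r = min e \<rho> / 2"
  have r: "r > 0" "r < e" "r < \<rho>" using e \<rho> by (auto simp: r_def)
  \<comment> \<open>The weight \<open>1 / (4 r)\<close> balances two demands: on the sphere the quadratic term is \<open>r / 4 > r / 8\<close>,
    and its gradient has length at most \<open>1 / 2\<close>, less than that of \<open>g\<close>.\<close>
  define B where "B x = g x + 1 / (4 * r) * (norm (x - x0))\<^sup>2" for x
  define K where "K = closure \<Omega> \<inter> cball x0 r \<inter> {x. - (r / 8) \<le> g x}"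
  define S where "S = closure \<Omega> \<inter> cball x0 r \<inter> {x. g x = - (r / 8)}"
  have clg: "closed {x. - (r / 8) \<le> g x}" "closed {x. g x = - (r / 8)}"
    by (auto intro!: closed_Collect_le closed_Collect_eq contg)
  have comp: "compact K" "compact S"
    unfolding K_def S_def
    by (intro compact_Int_closed[OF closed_Int_compact[OF closed_closure compact_cball]] clg)+
  have sub: "K \<subseteq> closure \<Omega> \<inter> ball x0 e" "S \<subseteq> closure \<Omega> \<inter> ball x0 e"
    using r by (auto simp: K_def S_def)
  have "\<exists>\<sigma>>0. \<forall>x\<in>S. w x \<ge> w x0 + \<sigma>"
  proof (cases "S = {}")
    case False
    obtain y where y: "y \<in> S" "\<And>x. x \<in> S \<Longrightarrow> w y \<le> w x"
      using continuous_attains_inf[OF comp(2) False] continuous_on_subset[OF cont sub(2)] by blast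
    have "y \<in> \<Omega>" using y(1) r \<Omega>g by (force simp: S_def)
    then have "w y > w x0" using interior y(1) sub by blast
    then show ?thesis using y(2) by (intro exI[of _ "w y - w x0"]) auto
  qed (auto intro: exI[of _ 1])
  then obtain \<sigma> where \<sigma>: "\<sigma> > 0" "\<And>x. x \<in> S \<Longrightarrow> w x \<ge> w x0 + \<sigma>" by blast
  define A where "A = real DIM(real \<times> 'b) * (\<bar>M\<bar> + 1 / (2 * r))"
  \<comment> \<open>The first bound on \<open>\<epsilon>\<close> protects the inner face, the second one the sign of the Laplacian.\<close>
  define \<epsilon> where "\<epsilon> = min (\<sigma> / r) (\<kappa> / (2 * (A + 1)))"
  have A0: "A \<ge> 0" using r by (simp add: A_def)
  have \<epsilon>0: "\<epsilon> > 0" using \<sigma>(1) r \<kappa> A0 by (simp add: \<epsilon>_def)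
  have \<epsilon>1: "\<epsilon> * (r / 8) < \<sigma>"
  proof -
    have "\<epsilon> \<le> \<sigma> / r" by (simp add: \<epsilon>_def)
    then have "\<epsilon> * r \<le> \<sigma>" using r by (simp add: field_simps)
    moreover have "\<epsilon> * r > 0" using \<epsilon>0 r by simp
    ultimately show ?thesis by simp
  qed
  have \<epsilon>2: "\<epsilon> * A < \<kappa>"
  proof -
    have "\<epsilon> * A \<le> \<kappa> / (2 * (A + 1)) * A" using A0 by (intro mult_right_mono) (auto simp: \<epsilon>_def)
    also have "\<dots> < \<kappa>" using A0 \<kappa> by (simp add: field_simps add_nonneg_pos)
    finally show ?thesis .
  qed
  define h where "h x = w x + \<epsilon> * B x" for x
  have contB: "continuous_on T B" for T
    unfolding B_def by (intro continuous_intros contg)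
  have "x0 \<in> K" using x0 r g0 by (simp add: K_def)
  moreover have "continuous_on K h"
    unfolding h_def by (intro continuous_intros contB continuous_on_subset[OF cont sub(1)])
  ultimately obtain y where y: "y \<in> K" "\<And>x. x \<in> K \<Longrightarrow> h y \<le> h x"
    using continuous_attains_inf[OF comp(1), of h] by blast
  have "h y \<le> w x0" using y(2)[OF \<open>x0 \<in> K\<close>] by (simp add: h_def B_def g0)
  have wy: "w y \<ge> w x0" using y(1) sub min by blast
  have ygt: "g y > - (r / 8)"
  proof (rule ccontr)
    assume "\<not> g y > - (r / 8)"
    then have "y \<in> S" "g y = - (r / 8)" using y(1) by (auto simp: K_def S_def)
    then have "B y \<ge> - (r / 8)" using r by (simp add: B_def)
    then have "\<epsilon> * B y \<ge> \<epsilon> * - (r / 8)" using \<epsilon>0 by (intro mult_left_mono) auto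
    then have "h y > w x0" using \<sigma>(2)[OF \<open>y \<in> S\<close>] \<epsilon>1 by (simp add: h_def)
    then show False using \<open>h y \<le> w x0\<close> by simp
  qed
  have yball: "y \<in> ball x0 r"
  proof (rule ccontr)
    assume "y \<notin> ball x0 r"
    then have n: "norm (y - x0) = r" using y(1) by (auto simp: K_def dist_norm norm_minus_commute)
    have "B y > 0" unfolding B_def n using ygt r by (simp add: power2_eq_square)
    then have "\<epsilon> * B y > 0" using \<epsilon>0 by simp
    then show False using \<open>h y \<le> w x0\<close> wy by (simp add: h_def)
  qed
  have ball_e: "y \<in> ball x0 e" and ball_\<rho>: "y \<in> ball x0 \<rho>" using yball r by auto
  have y_cl: "y \<in> closure \<Omega>" using y(1) by (simp add: K_def)
  have near: "\<forall>\<^sub>F t in nhds 0. y + t *\<^sub>R b \<in> ball x0 r \<inter> {x. - (r / 8) < g x}" for b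
    by (intro eventually_along_line open_Int open_ball open_Collect_less contg)
      (use yball ygt in auto)
  show False
  proof (cases "y \<in> \<Omega>")
    case True
    obtain D where D: "\<And>b. b \<in> Basis \<Longrightarrow> line_deriv2 w y b (D b)" "(\<Sum>b\<in>Basis. D b) \<le> - \<kappa>"
      using lap[OF True ball_e] by blast
    have "D b \<ge> - (\<epsilon> * (\<bar>M\<bar> + 1 / (2 * r)))" if b: "b \<in> Basis" for b
    proof -
      obtain E where E: "E \<le> M" "line_deriv2 g y b E" using g2[OF b] by blast
      have "line_deriv2 h y b (D b + \<epsilon> * (E + 1 / (4 * r) * 2))"
        unfolding h_def B_def
        by (intro line_deriv2_add line_deriv2_cmult line_deriv2_norm_square D E b)
      moreover have "\<forall>\<^sub>F t in nhds 0. h y \<le> h (y + t *\<^sub>R b)"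
        using eventually_conj[OF near[of b] eventually_along_line[OF opn True, of b]]
        by (rule eventually_mono) (auto simp: K_def intro!: y(2) closure_subset[THEN subsetD])
      ultimately have "D b + \<epsilon> * (E + 1 / (4 * r) * 2) \<ge> 0"
        by (rule line_deriv2_nonneg_at_minimum)
      moreover have "\<epsilon> * (E + 1 / (4 * r) * 2) \<le> \<epsilon> * (\<bar>M\<bar> + 1 / (2 * r))"
        using E(1) \<epsilon>0 by (intro mult_left_mono) auto
      ultimately show ?thesis by linarith
    qed
    then have "(\<Sum>b\<in>(Basis::(real \<times> 'b) set). - (\<epsilon> * (\<bar>M\<bar> + 1 / (2 * r)))) \<le> (\<Sum>b\<in>Basis. D b)"
      by (rule sum_mono)
    then have "- (\<epsilon> * A) \<le> (\<Sum>b\<in>Basis. D b)" by (simp add: A_def algebra_simps)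
    with D(2) \<epsilon>2 show False by linarith
  next
    case False
    then have y_fr: "y \<in> frontier \<Omega>" using cl y_cl by blast
    obtain \<gamma> where \<gamma>: "(w has_derivative (\<lambda>h. h \<bullet> \<gamma>)) (at y within closure \<Omega>)"
      "\<gamma> \<bullet> outward_normal \<Omega> y \<ge> 0" using nor[OF y_fr ball_e] by blast
    define \<nu> where "\<nu> = outward_normal \<Omega> y"
    have \<nu>: "\<nu> = G y /\<^sub>R norm (G y)" and gy: "g y = 0" using fr[OF y_fr ball_\<rho>] by (auto simp: \<nu>_def)
    have Gn: "G y \<noteq> 0" using nG[of y] by auto
    then have n\<nu>: "norm \<nu> = 1" by (simp add: \<nu>)
    have G\<nu>: "\<nu> \<bullet> G y = norm (G y)"
      using Gn by (simp add: \<nu> power2_norm_eq_inner[symmetric] power2_eq_square)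
    have gder: "(g has_derivative (\<lambda>h. h \<bullet> G y)) (at y)" using gd[of y] by (simp add: gderiv_def)
    have "((\<lambda>t. g (y + t *\<^sub>R (-\<nu>))) has_real_derivative (- \<nu>) \<bullet> G y) (at 0)"
      using DERIV_along_line[of g "\<lambda>h. h \<bullet> G y" y 0 "-\<nu>"] gder by simp
    moreover have "(- \<nu>) \<bullet> G y < 0" using Gn by (simp add: G\<nu>)
    ultimately have "\<exists>d>0. \<forall>t>0. t < d \<longrightarrow> g (y + (0 + t) *\<^sub>R (-\<nu>)) < g (y + 0 *\<^sub>R (-\<nu>))"
      by (rule DERIV_neg_dec_right)
    then obtain d1 where d1: "d1 > 0" "\<And>t. 0 < t \<Longrightarrow> t < d1 \<Longrightarrow> g (y + t *\<^sub>R (-\<nu>)) < 0"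
      using gy by auto
    obtain d2 where d2: "d2 > 0"
      "\<And>t. \<bar>t\<bar> < d2 \<Longrightarrow> y + t *\<^sub>R (-\<nu>) \<in> ball x0 r \<inter> {x. - (r / 8) < g x}"
      using near[of "-\<nu>"] unfolding eventually_nhds_metric dist_real_def by auto
    define I where "I = {0..<min d1 d2}"
    have inK: "y + t *\<^sub>R (-\<nu>) \<in> K" if "t \<in> I" for t
    proof (cases "t = 0")
      case False
      then have t: "0 < t" "t < d1" "t < d2" using that by (auto simp: I_def)
      have "y + t *\<^sub>R (-\<nu>) \<in> {z \<in> ball x0 \<rho>. g z < 0}"
        using d1(2)[OF t(1,2)] d2(2)[of t] t r by auto
      then have "y + t *\<^sub>R (-\<nu>) \<in> \<Omega>" unfolding \<Omega>g[symmetric] by blast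
      then show ?thesis using d2(2)[of t] t closure_subset[of \<Omega>] by (force simp: K_def)
    qed (use y(1) in simp)
    have B': "(B has_derivative (\<lambda>k. k \<bullet> (G y + (1 / (2 * r)) *\<^sub>R (y - x0)))) (at y within closure \<Omega>)"
    proof -
      have "((\<lambda>x. g x + c * ((x - x0) \<bullet> (x - x0))) has_derivative
        (\<lambda>k. k \<bullet> G y + c * ((y - x0) \<bullet> k + k \<bullet> (y - x0)))) (at y within closure \<Omega>)" for c
        by (auto intro!: derivative_eq_intros has_derivative_at_withinI[OF gder])
      note this[of "1 / (4 * r)"]
      moreover have "(\<lambda>k. k \<bullet> G y + 1 / (4 * r) * ((y - x0) \<bullet> k + k \<bullet> (y - x0)))
        = (\<lambda>k. k \<bullet> (G y + (1 / (2 * r)) *\<^sub>R (y - x0)))"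
        by (simp add: inner_add_right inner_commute[of "y - x0"] fun_eq_iff)
      ultimately show ?thesis unfolding B_def power2_norm_eq_inner by simp
    qed
    define \<beta> where "\<beta> = \<gamma> + \<epsilon> *\<^sub>R (G y + (1 / (2 * r)) *\<^sub>R (y - x0))"
    have h': "(h has_derivative (\<lambda>k. k \<bullet> \<beta>)) (at y within closure \<Omega>)"
    proof -
      have "(h has_derivative (\<lambda>k. k \<bullet> \<gamma> + \<epsilon> * (k \<bullet> (G y + (1 / (2 * r)) *\<^sub>R (y - x0))))) (at y within closure \<Omega>)"
        unfolding h_def by (intro has_derivative_add has_derivative_mult_right \<gamma>(1) B')
      then show ?thesis by (simp add: \<beta>_def inner_add_right)
    qed
    have "\<nu> \<bullet> \<beta> > 0"
    proof -
      have "\<bar>\<nu> \<bullet> (y - x0)\<bar> \<le> r"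
        using Cauchy_Schwarz_ineq2[of \<nu> "y - x0"] n\<nu> yball by (simp add: dist_norm norm_minus_commute)
      then have "1 / (2 * r) * (\<nu> \<bullet> (y - x0)) \<ge> 1 / (2 * r) * (- r)"
        using r by (intro mult_left_mono) auto
      then have "1 / (2 * r) * (\<nu> \<bullet> (y - x0)) \<ge> - (1 / 2)" using r by simp
      then have "\<nu> \<bullet> (G y + (1 / (2 * r)) *\<^sub>R (y - x0)) > 0"
        using nG[of y] by (simp add: inner_add_right G\<nu>)
      then have "\<epsilon> * (\<nu> \<bullet> (G y + (1 / (2 * r)) *\<^sub>R (y - x0))) > 0" using \<epsilon>0 by simp
      then show ?thesis using \<gamma>(2) unfolding \<beta>_def \<nu>_def[symmetric]
        by (simp add: inner_add_right[of \<nu> \<gamma>] inner_commute[of \<gamma>])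
    qed
    have "((\<lambda>t. h (y + t *\<^sub>R (-\<nu>))) has_real_derivative (- \<nu>) \<bullet> \<beta>) (at 0 within I)"
    proof -
      have "((\<lambda>t. y + t *\<^sub>R (-\<nu>)) has_derivative (\<lambda>t. t *\<^sub>R (-\<nu>))) (at 0 within I)"
        by (auto intro!: derivative_eq_intros)
      moreover have "(h has_derivative (\<lambda>k. k \<bullet> \<beta>)) (at (y + 0 *\<^sub>R (-\<nu>)) within (\<lambda>t. y + t *\<^sub>R (-\<nu>)) ` I)"
        using h' inK by (auto intro!: has_derivative_subset[OF h'] simp: K_def)
      ultimately have "(h \<circ> (\<lambda>t. y + t *\<^sub>R (-\<nu>)) has_derivative (\<lambda>k. k \<bullet> \<beta>) \<circ> (\<lambda>t. t *\<^sub>R (-\<nu>))) (at 0 within I)"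
        by (rule diff_chain_within)
      moreover have "(\<lambda>k. k \<bullet> \<beta>) \<circ> (\<lambda>t. t *\<^sub>R (-\<nu>)) = (*) ((- \<nu>) \<bullet> \<beta>)"
        by (simp add: fun_eq_iff)
      ultimately show ?thesis by (simp only: has_field_derivative_def o_def)
    qed
    moreover have "(- \<nu>) \<bullet> \<beta> < 0" using \<open>\<nu> \<bullet> \<beta> > 0\<close> by simp
    ultimately obtain d3 where d3: "d3 > 0"
      "\<And>t. t > 0 \<Longrightarrow> 0 + t \<in> I \<Longrightarrow> t < d3 \<Longrightarrow> h (y + (0 + t) *\<^sub>R (-\<nu>)) < h (y + 0 *\<^sub>R (-\<nu>))"
      using has_real_derivative_neg_dec_right by blast
    define t where "t = min (min d1 d2) d3 / 2"
    have "t > 0" "t \<in> I" "t < d3" using d1(1) d2(1) d3(1) by (auto simp: t_def I_def)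
    then have "h (y + t *\<^sub>R (-\<nu>)) < h y" using d3(2)[of t] by simp
    then show False using y(2)[OF inK[OF \<open>t \<in> I\<close>]] by simp
  qed
qed

section \<open>A decreasing profile for bistable nonlinearities\<close>

text \<open>The nonlinearity is given on \<open>[0,1]\<close>; the subsolutions also take negative values.\<close>

definition clamped :: "(real \<Rightarrow> real) \<Rightarrow> real \<Rightarrow> real" where
  "clamped f s = f (max 0 (min 1 s))"

lemma clamped_eq: "0 \<le> s \<Longrightarrow> s \<le> 1 \<Longrightarrow> clamped f s = f s"
  by (simp add: clamped_def)

lemma continuous_on_clamped:
  assumes "continuous_on {0..1} f"
  shows "continuous_on UNIV (clamped f)"
  unfolding clamped_def
  by (rule continuous_on_compose2[OF assms]) (auto intro!: continuous_intros)

lemma bistable_continuous: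
  assumes "bistable f \<theta>"
  shows "continuous_on {0..1} f"
proof -
  obtain f' where "\<And>s. s \<in> {0..1} \<Longrightarrow> (f has_real_derivative f' s) (at s within {0..1})"
    using assms unfolding bistable_def by blast
  then show ?thesis by (rule DERIV_continuous_on)
qed

lemma continuous_antiderivative:
  fixes f :: "real \<Rightarrow> real"
  assumes "continuous_on UNIV f"
  obtains F where "\<And>x. (F has_real_derivative f x) (at x)"
proof -
  have "isCont f x" for x using assms by (simp add: continuous_on_eq_continuous_at)
  then have "\<exists>F. \<forall>x. -\<infinity> < ereal x \<longrightarrow> ereal x < \<infinity> \<longrightarrow> (F has_vector_derivative f x) (at x)"
    by (intro einterval_antiderivative) auto
  then show thesis using that by (auto simp: has_real_derivative_iff_has_vector_derivative)
qed

text \<open>Separation of variables: \<open>h\<close> is the inverse of the antiderivative of \<open>- 1 / P\<close> that vanishes at \<open>s0\<close>. The two bounds on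
\<open>P\<close> make this antiderivative a bi-Lipschitz bijection of the line.\<close>

lemma decreasing_autonomous_flow:
  fixes P :: "real \<Rightarrow> real"
  assumes cont: "continuous_on UNIV P" and p0: "p0 > 0" and P: "\<And>s. p0 \<le> P s" "\<And>s. P s \<le> p1"
  obtains h where "h 0 = s0" "\<And>r. (h has_real_derivative - P (h r)) (at r)"
proof -
  have Ppos: "P s > 0" for s using P(1)[of s] p0 by linarith
  have p1: "p1 > 0" using Ppos[of 0] P(2)[of 0] by linarith
  have "continuous_on UNIV (\<lambda>s. 1 / P s)"
    using Ppos by (intro continuous_intros cont) (metis less_irrefl)
  then obtain F where F: "\<And>x. (F has_real_derivative 1 / P x) (at x)"
    using continuous_antiderivative by blast
  define Z where "Z s = F s0 - F s" for s
  have Z: "(Z has_real_derivative - (1 / P s)) (at s)" for s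
    unfolding Z_def by (auto intro!: derivative_eq_intros F)
  have slope: "Z s - Z t \<ge> (t - s) / p1" if "s \<le> t" for s t
  proof (cases "s = t")
    case False
    then have "s < t" using that by simp
    then obtain z where "Z t - Z s = (t - s) * (- (1 / P z))"
      using MVT2[of s t Z "\<lambda>s. - (1 / P s)"] Z by blast
    moreover have "1 / p1 \<le> 1 / P z" using P(2) Ppos by (intro divide_left_mono) (auto simp: p1)
    then have "(t - s) * (1 / p1) \<le> (t - s) * (1 / P z)" using that by (intro mult_left_mono) auto
    ultimately show ?thesis by simp
  qed simp
  have slope': "\<bar>s - t\<bar> \<le> p1 * \<bar>Z s - Z t\<bar>" for s t
  proof -
    have *: "\<bar>s - t\<bar> \<le> p1 * \<bar>Z s - Z t\<bar>" if "s \<le> t" for s t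
    proof -
      have "\<bar>s - t\<bar> \<le> p1 * (Z s - Z t)" using slope[OF that] that p1 by (simp add: field_simps)
      also have "\<dots> \<le> p1 * \<bar>Z s - Z t\<bar>" using p1 by (intro mult_left_mono) auto
      finally show ?thesis .
    qed
    show ?thesis using *[of s t] *[of t s] by (cases "s \<le> t") (simp_all add: abs_minus_commute)
  qed
  have Z0: "Z s0 = 0" by (simp add: Z_def)
  have "\<exists>s. Z s = r" for r
  proof -
    define a where "a = s0 - p1 * \<bar>r\<bar>"
    define b where "b = s0 + p1 * \<bar>r\<bar>"
    have ab: "a \<le> s0" "s0 \<le> b" using p1 by (auto simp: a_def b_def)
    have "Z a \<ge> \<bar>r\<bar>" "Z b \<le> - \<bar>r\<bar>"
      using slope[OF ab(1)] slope[OF ab(2)] Z0 p1 by (auto simp: a_def b_def)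
    then have "Z b \<le> r" "r \<le> Z a" by auto
    then have "\<exists>x. a \<le> x \<and> x \<le> b \<and> Z x = r"
      using ab Z by (intro IVT2) (auto intro: DERIV_isCont)
    then show ?thesis by blast
  qed
  then have "surj Z" unfolding surj_def by metis
  then have ZZ: "Z (inv Z r) = r" for r by (rule surj_f_inv_f)
  have lip: "\<bar>inv Z r - inv Z t\<bar> \<le> p1 * \<bar>r - t\<bar>" for r t
    using slope'[of "inv Z r" "inv Z t"] by (simp add: ZZ)
  show thesis
  proof (rule that[of "inv Z"])
    show "inv Z 0 = s0" using slope'[of "inv Z 0" s0] by (simp add: ZZ Z0)
    fix r
    have "p1-lipschitz_on UNIV (inv Z)"
      using p1 lip by (intro lipschitz_onI) (auto simp: dist_real_def)
    then have "isCont (inv Z) r"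
      using lipschitz_on_continuous_on continuous_on_eq_continuous_at open_UNIV by blast
    then have "DERIV (inv Z) r :> inverse (- (1 / P (inv Z r)))"
      using Ppos[of "inv Z r"]
      by (intro DERIV_inverse_function[OF Z, of _ _ "r - 1" "r + 1"]) (auto simp: ZZ)
    then show "DERIV (inv Z) r :> - P (inv Z r)" by simp
  qed
qed

text \<open>The primitive \<open>F\<close> of \<open>f\<close> decreases on \<open>[0,\<theta>]\<close>, increases on \<open>[\<theta>,1]\<close>, and \<open>F 0 < F 1\<close>. If \<open>m2 < 1\<close> is so large that
\<open>F 0 < F m2\<close>, then \<open>F m2\<close> is the maximum of \<open>F\<close> on \<open>[0,m2]\<close>, and a little further right, at \<open>m1\<close>, the
energy \<open>F m1 - F s\<close> dominates a small linear function of \<open>m1 - s\<close>: near \<open>m1\<close> since \<open>f\<close> is bounded below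
there, and elsewhere since \<open>F m1 - F m2\<close> is positive.\<close>

lemma bistable_energy:
  assumes bis: "bistable f \<theta>" and F: "\<And>s. (F has_real_derivative clamped f s) (at s)"
  obtains m1 m \<kappa> where "\<theta> < m1" "m1 < m" "m < 1" "\<kappa> > 0" "\<And>s. s \<in> {m1..m} \<Longrightarrow> \<kappa> \<le> f s"
    "\<And>s. s \<in> {0..m1} \<Longrightarrow> \<kappa> * (m1 - s) \<le> F m1 - F s" "\<And>s. s \<in> {0..m1} \<Longrightarrow> F \<theta> \<le> F s"
proof -
  have \<theta>: "0 < \<theta>" "\<theta> < 1" and f0: "f 0 = 0" "f \<theta> = 0" "f 1 = 0"
    and neg: "\<And>s. 0 < s \<Longrightarrow> s < \<theta> \<Longrightarrow> f s < 0" and pos: "\<And>s. \<theta> < s \<Longrightarrow> s < 1 \<Longrightarrow> f s > 0"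
    and int: "integral {0..1} f > 0" using bis by (auto simp: bistable_def)
  have contf: "continuous_on {0..1} f" using bis by (rule bistable_continuous)
  have contF: "isCont F s" for s using F by (rule DERIV_isCont)
  have "(clamped f has_integral F 1 - F 0) {0..1}"
    using has_field_derivative_at_within[OF F]
    by (intro fundamental_theorem_of_calculus) (simp_all add: has_real_derivative_iff_has_vector_derivative)
  then have "(f has_integral F 1 - F 0) {0..1}"
    by (rule has_integral_eq[rotated]) (auto simp: clamped_eq)
  then have F10: "F 0 < F 1" using int by (simp add: integral_unique)
  have dec: "F t \<le> F s" if "0 \<le> s" "s \<le> t" "t \<le> \<theta>" for s t
  proof (rule DERIV_nonpos_imp_nonincreasing[OF that(2)])
    fix x assume "s \<le> x" "x \<le> t"
    then have "clamped f x \<le> 0" using that \<theta> neg[of x] f0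
      by (cases "x = 0 \<or> x = \<theta>") (auto simp: clamped_eq)
    then show "\<exists>y. DERIV F x :> y \<and> y \<le> 0" using F by blast
  qed
  have inc: "F s \<le> F t" if "\<theta> \<le> s" "s \<le> t" "t \<le> 1" for s t
  proof (rule DERIV_nonneg_imp_nondecreasing[OF that(2)])
    fix x assume "s \<le> x" "x \<le> t"
    then have "clamped f x \<ge> 0" using that \<theta> pos[of x] f0
      by (cases "x = 1 \<or> x = \<theta>") (auto simp: clamped_eq)
    then show "\<exists>y. DERIV F x :> y \<and> y \<ge> 0" using F by blast
  qed
  have "(F \<longlongrightarrow> F 1) (at_left 1)"
    using contF[of 1] unfolding isCont_def by (rule tendsto_mono[OF at_le, rotated]) simp
  then have "\<forall>\<^sub>F s in at_left 1. F 0 < F s" using F10 by (rule order_tendstoD)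
  moreover have "\<forall>\<^sub>F s in at_left 1. s \<in> {\<theta><..<1}"
    using \<theta> by (intro eventually_at_left_real)
  ultimately have "\<forall>\<^sub>F s in at_left (1::real). F 0 < F s \<and> s \<in> {\<theta><..<1}"
    by (rule eventually_conj)
  then obtain m2 where m2: "F 0 < F m2" "\<theta> < m2" "m2 < 1"
    using eventually_happens'[OF trivial_limit_at_left_real] by fastforce
  define m1 where "m1 = (m2 + 1) / 2"
  define m where "m = (m1 + 1) / 2"
  have m: "m2 < m1" "m1 < m" "m < 1" using m2 by (auto simp: m1_def m_def)
  have "continuous_on {m2..m} f" using m2 m \<theta> by (intro continuous_on_subset[OF contf]) auto
  then obtain s0 where s0: "s0 \<in> {m2..m}" "\<And>s. s \<in> {m2..m} \<Longrightarrow> f s0 \<le> f s"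
    using continuous_attains_inf[of "{m2..m}" f] m by auto
  have fs0: "f s0 > 0" using s0(1) m2 m by (intro pos) auto
  have F21: "F m2 < F m1"
  proof (rule DERIV_pos_imp_increasing[OF m(1)])
    fix x assume x: "m2 \<le> x" "x \<le> m1"
    then have "clamped f x > 0" using m2 m \<theta> pos[of x] by (simp add: clamped_eq)
    then show "\<exists>y. DERIV F x :> y \<and> y > 0" using F by blast
  qed
  \<comment> \<open>The second entry suffices for \<open>s < m2\<close>, as \<open>m1 - s \<le> 1\<close>.\<close>
  define \<kappa> where "\<kappa> = min (f s0) (F m1 - F m2)"
  show thesis
  proof (rule that[of m1 m \<kappa>])
    show "\<theta> < m1" "m1 < m" "m < 1" using m m2 by auto
    show "\<kappa> > 0" using fs0 F21 by (simp add: \<kappa>_def)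
    show "\<kappa> \<le> f s" if "s \<in> {m1..m}" for s using s0(2)[of s] that m by (auto simp: \<kappa>_def)
    show "F \<theta> \<le> F s" if "s \<in> {0..m1}" for s
      using dec[of s \<theta>] inc[of \<theta> s] that m by (cases "s \<le> \<theta>") auto
    show "\<kappa> * (m1 - s) \<le> F m1 - F s" if s: "s \<in> {0..m1}" for s
    proof (cases "s \<ge> m2")
      case True
      have "F s - \<kappa> * s \<le> F m1 - \<kappa> * m1"
      proof (rule DERIV_nonneg_imp_nondecreasing[of s m1 "\<lambda>s. F s - \<kappa> * s"])
        fix x assume x: "s \<le> x" "x \<le> m1"
        then have "clamped f x - \<kappa> \<ge> 0" using s0(2)[of x] True m m2 \<theta> by (simp add: clamped_eq \<kappa>_def)
        moreover have "DERIV (\<lambda>s. F s - \<kappa> * s) x :> clamped f x - \<kappa>"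
          by (auto intro!: derivative_eq_intros F)
        ultimately show "\<exists>y. DERIV (\<lambda>s. F s - \<kappa> * s) x :> y \<and> y \<ge> 0" by blast
      qed (use s in auto)
      then show ?thesis by (simp add: algebra_simps)
    next
      case False
      have "F s \<le> F m2"
        using dec[of 0 s] inc[of s m2] False s m2 by (cases "s \<le> \<theta>") auto
      then have "\<kappa> \<le> F m1 - F s" by (simp add: \<kappa>_def)
      moreover have "\<kappa> * (m1 - s) \<le> \<kappa> * 1"
        using \<open>0 < f s0\<close> F21 s m by (intro mult_left_mono) (auto simp: \<kappa>_def)
      ultimately show ?thesis by simp
    qed
  qed
qed

text \<open>A decreasing solution of \<open>h'' + f(h) = \<kappa>\<close> is found from its energy: with
\<open>q s = p\<^sup>2 / 2 + (F m1 - F s) - \<kappa> (m1 - s)\<close> one has \<open>q' = \<kappa> - f\<close>, and \<open>h' = - sqrt (2 q(h))\<close> implies \<open>h'' = q'(h)\<close>. By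
\<open>bistable_energy\<close>, \<open>q\<close> is at least \<open>p\<^sup>2 / 2\<close> on \<open>[0,m1]\<close>, so \<open>h\<close> reaches \<open>0\<close>. It is essential that \<open>\<kappa>\<close> and the slope
bound \<open>P\<close> are chosen before \<open>p\<close>: the radius at which the curvature becomes negligible depends on them,
and \<open>p\<close> has to be small compared with the inverse of that radius.\<close>

lemma bistable_profile:
  assumes bis: "bistable f \<theta>"
  obtains m1 m \<kappa> P where "\<theta> < m1" "m1 < m" "m < 1" "\<kappa> > 0" "\<And>s. s \<in> {m1..m} \<Longrightarrow> \<kappa> \<le> f s"
    "\<And>p. 0 < p \<Longrightarrow> p \<le> 1 \<Longrightarrow> \<exists>h h' \<rho> J. h 0 = m1 \<and> h' 0 = - p \<and> \<rho> > 0 \<and> h \<rho> = 0 \<and>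
       (\<forall>r. (h has_real_derivative h' r) (at r)) \<and> (\<forall>r. - P \<le> h' r \<and> h' r < 0) \<and>
       open J \<and> {0..\<rho>} \<subseteq> J \<and> (\<forall>r\<in>J. (h' has_real_derivative \<kappa> - clamped f (h r)) (at r))"
proof -
  have contc: "continuous_on UNIV (clamped f)"
    using bis by (intro continuous_on_clamped bistable_continuous)
  then obtain F where F: "\<And>s. (F has_real_derivative clamped f s) (at s)"
    using continuous_antiderivative by blast
  have contF: "continuous_on S F" for S
    using F by (auto intro!: continuous_at_imp_continuous_on DERIV_isCont)
  obtain m1 m \<kappa> where m: "\<theta> < m1" "m1 < m" "m < 1" "\<kappa> > 0" "\<And>s. s \<in> {m1..m} \<Longrightarrow> \<kappa> \<le> f s"
    and low: "\<And>s. s \<in> {0..m1} \<Longrightarrow> \<kappa> * (m1 - s) \<le> F m1 - F s"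
    and up: "\<And>s. s \<in> {0..m1} \<Longrightarrow> F \<theta> \<le> F s"
    using bistable_energy[OF bis F] by metis
  have \<theta>: "0 < \<theta>" using bis by (simp add: bistable_def)
  define Q where "Q = 2 + F m1 - F \<theta>"
  have Q: "Q \<ge> 2" using up[of m1] m \<theta> by (simp add: Q_def)
  show thesis
  proof (rule that[OF m, of "sqrt (2 * Q)"])
    fix p :: real assume p: "0 < p" "p \<le> 1"
    define q where "q s = p\<^sup>2 / 2 + (F m1 - F s) - \<kappa> * (m1 - s)" for s
    \<comment> \<open>Truncation makes the speed \<open>V\<close> positive and bounded on the whole line; on \<open>[0,m1]\<close> neither bound is active.\<close>
    define V where "V s = sqrt (2 * max (p\<^sup>2 / 4) (min Q (q s)))" for s
    have p2: "p\<^sup>2 \<le> 1" "p\<^sup>2 > 0" using p by (auto simp: power_le_one)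
    have contq: "continuous_on S q" for S unfolding q_def by (intro continuous_intros contF)
    have q: "p\<^sup>2 / 4 < q s" "q s < Q" if "s \<in> {0..m1}" for s
    proof -
      have "p\<^sup>2 / 4 < p\<^sup>2 / 2" using p2 by simp
      then show "p\<^sup>2 / 4 < q s" using low[OF that] unfolding q_def by linarith
      have "0 \<le> \<kappa> * (m1 - s)" using that m by auto
      then show "q s < Q" using up[OF that] p2 unfolding q_def Q_def by linarith
    qed
    have V: "p / 2 \<le> V s" "V s \<le> sqrt (2 * Q)" for s
    proof -
      have "(p / 2)\<^sup>2 = p\<^sup>2 / 4" by (simp add: power_divide)
      then have "(p / 2)\<^sup>2 \<le> 2 * max (p\<^sup>2 / 4) (min Q (q s))"
        using p2(2) max.cobounded1[of "p\<^sup>2 / 4" "min Q (q s)"] by linarith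
      then show "p / 2 \<le> V s" unfolding V_def using p by (intro real_le_rsqrt)
      show "V s \<le> sqrt (2 * Q)" unfolding V_def
        by (intro real_sqrt_le_mono mult_left_mono max.boundedI min.cobounded1) (use p2 Q in auto)
    qed
    have "continuous_on UNIV V" unfolding V_def by (intro continuous_intros contq)
    then obtain h where h0: "h 0 = m1" and h: "\<And>r. (h has_real_derivative - V (h r)) (at r)"
      using decreasing_autonomous_flow[of V "p / 2" "sqrt (2 * Q)" m1] V p by auto
    have conth: "continuous_on S h" for S
      using h by (auto intro!: continuous_at_imp_continuous_on DERIV_isCont)
    have Vpos: "V s > 0" for s using V(1)[of s] p by linarith
    have hdec: "h t \<le> h s" if "s \<le> t" for s t
      using that by (rule DERIV_nonpos_imp_nonincreasing) (use h Vpos in \<open>metis neg_le_0_iff_le less_imp_le\<close>)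
    have "\<exists>\<rho>\<ge>0. \<rho> \<le> 2 * m1 / p \<and> h \<rho> = 0"
    proof (rule IVT2')
      have "h (2 * m1 / p) - h 0 \<le> 2 * m1 / p * (- (p / 2))"
      proof -
        have r: "0 < 2 * m1 / p" using m \<theta> p by simp
        obtain z where "h (2 * m1 / p) - h 0 = (2 * m1 / p - 0) * (- V (h z))"
          using MVT2[OF r, of h "\<lambda>r. - V (h r)"] h by blast
        moreover have "(2 * m1 / p) * (- V (h z)) \<le> (2 * m1 / p) * (- (p / 2))"
          using V(1) r by (intro mult_left_mono) auto
        ultimately show ?thesis by simp
      qed
      then show "h (2 * m1 / p) \<le> 0" using p h0 by simp
    qed (use m \<theta> p h0 conth in auto)
    then obtain \<rho> where \<rho>: "\<rho> \<ge> 0" "h \<rho> = 0" by blast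
    have "\<rho> \<noteq> 0" using \<rho> h0 m \<theta> by auto
    then have \<rho>0: "\<rho> > 0" using \<rho> by simp
    define J where "J = {r. p\<^sup>2 / 4 < q (h r) \<and> q (h r) < Q}"
    have contqh: "continuous_on UNIV (\<lambda>r. q (h r))"
      using continuous_on_compose2[OF contq[of UNIV] conth] by auto
    have "open J" unfolding J_def by (intro open_Collect_conj open_Collect_less contqh continuous_on_const)
    have "{0..\<rho>} \<subseteq> J"
    proof
      fix r assume "r \<in> {0..\<rho>}"
      then have "h r \<in> {0..m1}" using hdec[of 0 r] hdec[of r \<rho>] h0 \<rho> by auto
      then show "r \<in> J" using q by (simp add: J_def)
    qed
    have der: "((\<lambda>r. - V (h r)) has_real_derivative \<kappa> - clamped f (h r)) (at r)" if r: "r \<in> J" for r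
    proof -
      have Vq: "V (h t) = sqrt (2 * q (h t))" if "t \<in> J" for t
        using that by (simp add: V_def J_def)
      have "p\<^sup>2 / 4 < q (h r)" using r unfolding J_def by blast
      then have qpos: "q (h r) > 0" using p2(2) by linarith
      have "((\<lambda>s. q s) has_real_derivative \<kappa> - clamped f (h r)) (at (h r))"
        unfolding q_def by (auto intro!: derivative_eq_intros F)
      then have qh: "((\<lambda>r. q (h r)) has_real_derivative (\<kappa> - clamped f (h r)) * - V (h r)) (at r)"
        using h by (rule DERIV_chain2)
      have "((\<lambda>r. - sqrt (2 * q (h r))) has_real_derivative \<kappa> - clamped f (h r)) (at r)"
        using qpos r by (auto intro!: derivative_eq_intros qh simp: Vq field_simps)
      then show ?thesis
        by (rule has_field_derivative_transform_within_open[OF _ \<open>open J\<close> r]) (simp add: Vq)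
    qed
    have "V m1 = p"
      using q[of m1] p m \<theta> Q p2 by (simp add: V_def q_def real_sqrt_abs max_def min_def)
    then show "\<exists>h h' \<rho> J. h 0 = m1 \<and> h' 0 = - p \<and> \<rho> > 0 \<and> h \<rho> = 0 \<and>
       (\<forall>r. (h has_real_derivative h' r) (at r)) \<and> (\<forall>r. - sqrt (2 * Q) \<le> h' r \<and> h' r < 0) \<and>
       open J \<and> {0..\<rho>} \<subseteq> J \<and> (\<forall>r\<in>J. (h' has_real_derivative \<kappa> - clamped f (h r)) (at r))"
      using h0 \<rho>0 \<rho> h V Vpos \<open>open J\<close> \<open>{0..\<rho>} \<subseteq> J\<close> der
      by (intro exI[of _ h] exI[of _ "\<lambda>r. - V (h r)"] exI[of _ \<rho>] exI[of _ J]) simp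
  qed
qed

section \<open>Test functions touching a stationary solution\<close>

locale neumann_solution =
  fixes \<Omega> :: "(real \<times> 'b::euclidean_space) set" and \<alpha> :: real and F :: "real \<Rightarrow> real"
    and v :: "real \<times> 'b \<Rightarrow> real"
  assumes dom: "uniformly_C2_holder_domain \<alpha> \<Omega>"
    and cont_F: "continuous_on UNIV F"
    and cont_v: "continuous_on (closure \<Omega>) v"
    and C2_v: "C2_on \<Omega> v"
    and equation: "x \<in> \<Omega> \<Longrightarrow> laplacian v x + F (v x) = 0"
    and neumann: "x \<in> frontier \<Omega> \<Longrightarrow> \<exists>\<gamma>. (v has_derivative (\<lambda>h. h \<bullet> \<gamma>)) (at x within closure \<Omega>) \<and>
          \<gamma> \<bullet> outward_normal \<Omega> x = 0"
    and nonneg: "x \<in> closure \<Omega> \<Longrightarrow> 0 \<le> v x"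
begin

lemma open_domain: "open \<Omega>"
  using dom by (simp add: uniformly_C2_holder_domain_def)

text \<open>Near \<open>x0\<close> the function \<open>v - w\<close> satisfies \<open>\<Delta>(v - w) = - (F(v) + \<Delta>w)\<close>, and the right-hand side is negative by continuity
since \<open>v = w\<close> at \<open>x0\<close>. So \<open>no_boundary_minimum\<close> applies to it.\<close>

lemma touching:
  assumes x0: "x0 \<in> closure \<Omega>" and S: "open S" "x0 \<in> S"
    and cont_w: "continuous_on S w"
    and touch: "w x0 = v x0" and below: "\<And>x. x \<in> closure \<Omega> \<inter> S \<Longrightarrow> w x \<le> v x"
    and D: "\<And>x b. x \<in> S \<Longrightarrow> b \<in> Basis \<Longrightarrow> line_deriv2 w x b (D x b)"
    and L: "\<And>x. x \<in> S \<Longrightarrow> (\<Sum>b\<in>Basis. D x b) = L x" "isCont L x0"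
    and strict: "L x0 + F (v x0) > 0"
    and nor: "\<And>x. x \<in> frontier \<Omega> \<Longrightarrow> x \<in> S \<Longrightarrow>
      \<exists>\<gamma>. (w has_derivative (\<lambda>h. h \<bullet> \<gamma>)) (at x) \<and> \<gamma> \<bullet> outward_normal \<Omega> x \<le> 0"
  shows False
proof -
  define \<kappa> where "\<kappa> = (L x0 + F (v x0)) / 2"
  have \<kappa>: "\<kappa> > 0" "\<kappa> < L x0 + F (v x0)" using strict by (auto simp: \<kappa>_def)
  have v0: "(v \<longlongrightarrow> v x0) (at x0 within closure \<Omega>)"
    using cont_v x0 by (simp add: continuous_on_def)
  have "isCont F (v x0)" using cont_F by (simp add: continuous_on_eq_continuous_at)
  then have "((\<lambda>x. F (v x)) \<longlongrightarrow> F (v x0)) (at x0 within closure \<Omega>)"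
    using v0 by (rule isCont_tendsto_compose)
  moreover have "(L \<longlongrightarrow> L x0) (at x0 within closure \<Omega>)"
    using L(2) unfolding isCont_def by (rule tendsto_mono[OF at_le, rotated]) simp
  ultimately have "((\<lambda>x. L x + F (v x)) \<longlongrightarrow> L x0 + F (v x0)) (at x0 within closure \<Omega>)"
    by (intro tendsto_add)
  then have "\<forall>\<^sub>F x in at x0 within closure \<Omega>. \<kappa> < L x + F (v x)"
    using \<kappa>(2) by (rule order_tendstoD)
  then obtain d where d: "d > 0" "\<And>x. x \<in> closure \<Omega> \<Longrightarrow> x \<noteq> x0 \<Longrightarrow> dist x x0 < d \<Longrightarrow> \<kappa> < L x + F (v x)"
    unfolding eventually_at by blast
  obtain d' where d': "d' > 0" "ball x0 d' \<subseteq> S" using S openE by blast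
  define e where "e = min d d'"
  have e: "e > 0" "ball x0 e \<subseteq> S" using d d' by (auto simp: e_def)
  show False
  proof (rule no_boundary_minimum[OF dom x0 e(1) \<kappa>(1), of "\<lambda>x. v x - w x"])
    show "continuous_on (closure \<Omega> \<inter> ball x0 e) (\<lambda>x. v x - w x)"
      using e(2) by (intro continuous_intros continuous_on_subset[OF cont_v] continuous_on_subset[OF cont_w]) auto
    show "v x0 - w x0 \<le> v x - w x" if "x \<in> closure \<Omega>" "x \<in> ball x0 e" for x
      using below[of x] that e touch by auto
    show "\<exists>D'. (\<forall>b\<in>Basis. line_deriv2 (\<lambda>x. v x - w x) x b (D' b)) \<and> (\<Sum>b\<in>Basis. D' b) \<le> - \<kappa>"
      if x: "x \<in> \<Omega>" "x \<in> ball x0 e" for x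
    proof (intro exI conjI ballI)
      show "line_deriv2 (\<lambda>x. v x - w x) x b (partial b (partial b v) x - D x b)" if "b \<in> Basis" for b
        using x e that by (intro line_deriv2_diff D C2_on_line_deriv2_Basis[OF C2_v open_domain]) auto
      have "\<kappa> < L x + F (v x)"
        using d(2)[of x] x closure_subset[of \<Omega>] \<kappa>(2) by (cases "x = x0") (auto simp: e_def dist_commute)
      moreover have "(\<Sum>b\<in>Basis. partial b (partial b v) x - D x b) = laplacian v x - L x"
        using L(1)[of x] x e by (auto simp: sum_subtractf laplacian_def)
      ultimately show "(\<Sum>b\<in>Basis. partial b (partial b v) x - D x b) \<le> - \<kappa>"
        using equation[OF x(1)] by linarith
    qed
    show "\<exists>\<gamma>. ((\<lambda>x. v x - w x) has_derivative (\<lambda>h. h \<bullet> \<gamma>)) (at x within closure \<Omega>) \<and>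
        \<gamma> \<bullet> outward_normal \<Omega> x \<ge> 0" if x: "x \<in> frontier \<Omega>" "x \<in> ball x0 e" for x
    proof -
      obtain \<gamma> where \<gamma>: "(v has_derivative (\<lambda>h. h \<bullet> \<gamma>)) (at x within closure \<Omega>)"
        "\<gamma> \<bullet> outward_normal \<Omega> x = 0" using neumann[OF x(1)] by blast
      obtain \<beta> where \<beta>: "(w has_derivative (\<lambda>h. h \<bullet> \<beta>)) (at x)" "\<beta> \<bullet> outward_normal \<Omega> x \<le> 0"
        using nor[OF x(1)] x e by blast
      have "((\<lambda>x. v x - w x) has_derivative (\<lambda>h. h \<bullet> \<gamma> - h \<bullet> \<beta>)) (at x within closure \<Omega>)"
        by (intro has_derivative_diff \<gamma> has_derivative_at_withinI[OF \<beta>(1)])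
      then show ?thesis using \<gamma> \<beta>
        by (intro exI[of _ "\<gamma> - \<beta>"]) (simp add: inner_diff_right inner_diff_left)
    qed
  qed
qed

text \<open>For \<open>w = \<xi>(\<bar>x - c\<bar>\<^sup>2)\<close> the Laplacian is \<open>4 \<bar>x - c\<bar>\<^sup>2 \<xi>'' + 2 N \<xi>'\<close>, and the gradient is \<open>2 \<xi>' (x - c)\<close>. The square of the distance
is smooth at the centre too.\<close>

lemma radial_touching:
  assumes x0: "x0 \<in> closure \<Omega>" and touch: "\<xi> ((norm (x0 - c))\<^sup>2) = v x0"
    and below: "\<forall>\<^sub>F x in nhds x0. x \<in> closure \<Omega> \<longrightarrow> \<xi> ((norm (x - c))\<^sup>2) \<le> v x"
    and I: "open I" "(norm (x0 - c))\<^sup>2 \<in> I"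
    and \<xi>: "\<And>\<sigma>. \<sigma> \<in> I \<Longrightarrow> (\<xi> has_real_derivative \<xi>1 \<sigma>) (at \<sigma>)"
      "\<And>\<sigma>. \<sigma> \<in> I \<Longrightarrow> (\<xi>1 has_real_derivative \<xi>2 \<sigma>) (at \<sigma>)"
      "isCont \<xi>2 ((norm (x0 - c))\<^sup>2)"
    and strict: "4 * (norm (x0 - c))\<^sup>2 * \<xi>2 ((norm (x0 - c))\<^sup>2)
      + 2 * real DIM(real \<times> 'b) * \<xi>1 ((norm (x0 - c))\<^sup>2) + F (v x0) > 0"
    and nor: "\<forall>\<^sub>F x in nhds x0. x \<in> frontier \<Omega> \<longrightarrow>
      \<xi>1 ((norm (x - c))\<^sup>2) * ((x - c) \<bullet> outward_normal \<Omega> x) \<le> 0"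
  shows False
proof -
  obtain S' where S': "open S'" "x0 \<in> S'"
    "\<And>x. x \<in> S' \<Longrightarrow> x \<in> closure \<Omega> \<Longrightarrow> \<xi> ((norm (x - c))\<^sup>2) \<le> v x"
    "\<And>x. x \<in> S' \<Longrightarrow> x \<in> frontier \<Omega> \<Longrightarrow>
      \<xi>1 ((norm (x - c))\<^sup>2) * ((x - c) \<bullet> outward_normal \<Omega> x) \<le> 0"
    using eventually_conj[OF below nor] unfolding eventually_nhds by blast
  define \<sigma> where "\<sigma> x = (norm (x - c))\<^sup>2" for x
  define S where "S = S' \<inter> \<sigma> -` I"
  have cont\<sigma>: "continuous_on T \<sigma>" for T unfolding \<sigma>_def by (intro continuous_intros)
  have "open S" unfolding S_def using S'(1) I(1) continuous_on_open_vimage[of UNIV \<sigma>] cont\<sigma>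
    by (intro open_Int) auto
  have "x0 \<in> S" using S' I by (simp add: S_def \<sigma>_def)
  have cont\<xi>: "isCont \<xi> (\<sigma> x)" "isCont \<xi>1 (\<sigma> x)" if "x \<in> S" for x
    using that \<xi>(1,2) by (auto simp: S_def intro: DERIV_isCont)
  have cont\<sigma>': "isCont \<sigma> x" for x unfolding \<sigma>_def by (intro continuous_intros)
  show False
  proof (rule touching[OF x0 \<open>open S\<close> \<open>x0 \<in> S\<close>, of "\<lambda>x. \<xi> (\<sigma> x)"
        "\<lambda>x b. \<xi>2 (\<sigma> x) * (2 * ((x - c) \<bullet> b)) * (2 * ((x - c) \<bullet> b)) + 2 * \<xi>1 (\<sigma> x)"
        "\<lambda>x. 4 * \<sigma> x * \<xi>2 (\<sigma> x) + 2 * real DIM(real \<times> 'b) * \<xi>1 (\<sigma> x)"])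
    show "continuous_on S (\<lambda>x. \<xi> (\<sigma> x))"
      by (intro continuous_at_imp_continuous_on ballI isCont_o2[OF cont\<sigma>'] cont\<xi>)
    show "\<xi> (\<sigma> x0) = v x0" using touch by (simp add: \<sigma>_def)
    show "\<xi> (\<sigma> x) \<le> v x" if "x \<in> closure \<Omega> \<inter> S" for x
      using S'(3)[of x] that by (simp add: S_def \<sigma>_def)
    show "line_deriv2 (\<lambda>x. \<xi> (\<sigma> x)) x b
        (\<xi>2 (\<sigma> x) * (2 * ((x - c) \<bullet> b)) * (2 * ((x - c) \<bullet> b)) + 2 * \<xi>1 (\<sigma> x))"
      if x: "x \<in> S" and b: "b \<in> Basis" for x b
    proof (rule line_deriv2I)
      define y where "y = (x - c) \<bullet> b"
      have eq: "\<sigma> (x + t *\<^sub>R b) = \<sigma> x + 2 * t * y + t\<^sup>2" for t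
      proof -
        have "x + t *\<^sub>R b - c = (x - c) + t *\<^sub>R b" by simp
        then show ?thesis
          using b by (simp only: power2_norm_eq_inner \<sigma>_def)
            (simp add: inner_add_left inner_add_right inner_commute[of b "x - c"] power2_eq_square distrib_left y_def)
      qed
      have s: "((\<lambda>t. \<sigma> x + 2 * t * y + t\<^sup>2) has_real_derivative 2 * y + 2 * t) (at t)" for t
        by (auto intro!: derivative_eq_intros)
      show "\<forall>\<^sub>F t in nhds 0. ((\<lambda>t. \<xi> (\<sigma> (x + t *\<^sub>R b))) has_real_derivative
          \<xi>1 (\<sigma> x + 2 * t * y + t\<^sup>2) * (2 * y + 2 * t)) (at t)"
        using eventually_along_line[OF \<open>open S\<close> x, of b]
      proof eventually_elim
        case (elim t)
        then have "\<sigma> x + 2 * t * y + t\<^sup>2 \<in> I" by (simp add: S_def eq)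
        then show ?case unfolding eq by (intro DERIV_chain2[OF \<xi>(1) s])
      qed
      have "\<sigma> x + 2 * 0 * y + 0\<^sup>2 \<in> I" using x by (simp add: S_def)
      then have "((\<lambda>t. \<xi>1 (\<sigma> x + 2 * t * y + t\<^sup>2)) has_real_derivative
          \<xi>2 (\<sigma> x + 2 * 0 * y + 0\<^sup>2) * (2 * y + 2 * 0)) (at 0)"
        by (intro DERIV_chain2[OF \<xi>(2) s])
      then show "((\<lambda>t. \<xi>1 (\<sigma> x + 2 * t * y + t\<^sup>2) * (2 * y + 2 * t)) has_real_derivative
          \<xi>2 (\<sigma> x) * (2 * ((x - c) \<bullet> b)) * (2 * ((x - c) \<bullet> b)) + 2 * \<xi>1 (\<sigma> x)) (at 0)"
        by (auto intro!: derivative_eq_intros simp: y_def)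
    qed
    show "(\<Sum>b\<in>Basis. \<xi>2 (\<sigma> x) * (2 * ((x - c) \<bullet> b)) * (2 * ((x - c) \<bullet> b)) + 2 * \<xi>1 (\<sigma> x))
        = 4 * \<sigma> x * \<xi>2 (\<sigma> x) + 2 * real DIM(real \<times> 'b) * \<xi>1 (\<sigma> x)" for x
    proof -
      have "\<sigma> x = (\<Sum>b\<in>Basis. ((x - c) \<bullet> b) * ((x - c) \<bullet> b))"
        unfolding \<sigma>_def power2_norm_eq_inner by (rule euclidean_inner)
      then have "4 * \<sigma> x * \<xi>2 (\<sigma> x) + 2 * real DIM(real \<times> 'b) * \<xi>1 (\<sigma> x)
        = 4 * \<xi>2 (\<sigma> x) * (\<Sum>b\<in>Basis. ((x - c) \<bullet> b) * ((x - c) \<bullet> b))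
          + (\<Sum>b\<in>(Basis::(real \<times> 'b) set). 2 * \<xi>1 (\<sigma> x))"
        by simp
      also have "\<dots> = (\<Sum>b\<in>Basis. \<xi>2 (\<sigma> x) * (2 * ((x - c) \<bullet> b)) * (2 * ((x - c) \<bullet> b)) + 2 * \<xi>1 (\<sigma> x))"
        unfolding sum_distrib_left sum.distrib[symmetric] by (intro sum.cong refl) simp
      finally show ?thesis ..
    qed
    show "isCont (\<lambda>x. 4 * \<sigma> x * \<xi>2 (\<sigma> x) + 2 * real DIM(real \<times> 'b) * \<xi>1 (\<sigma> x)) x0"
      using \<xi>(3) \<open>x0 \<in> S\<close> unfolding \<sigma>_def[symmetric]
      by (intro isCont_add isCont_mult cont\<sigma>' isCont_o2[OF cont\<sigma>'] cont\<xi> continuous_const)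
    show "4 * \<sigma> x0 * \<xi>2 (\<sigma> x0) + 2 * real DIM(real \<times> 'b) * \<xi>1 (\<sigma> x0) + F (v x0) > 0"
      using strict by (simp add: \<sigma>_def)
    show "\<exists>\<gamma>. ((\<lambda>x. \<xi> (\<sigma> x)) has_derivative (\<lambda>h. h \<bullet> \<gamma>)) (at x) \<and> \<gamma> \<bullet> outward_normal \<Omega> x \<le> 0"
      if x: "x \<in> frontier \<Omega>" "x \<in> S" for x
    proof (intro exI conjI)
      have xI: "\<sigma> x \<in> I" using x by (simp add: S_def)
      have "(\<sigma> has_derivative (\<lambda>h. 2 * (h \<bullet> (x - c)))) (at x)"
        unfolding \<sigma>_def power2_norm_eq_inner by (auto intro!: derivative_eq_intros simp: inner_commute)
      then have "((\<lambda>x. \<xi> (\<sigma> x)) has_derivative (\<lambda>h. 2 * (h \<bullet> (x - c)) * \<xi>1 (\<sigma> x))) (at x)"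
        by (rule DERIV_compose_FDERIV[where f=\<xi> and g=\<sigma> and x=x, OF \<xi>(1)[OF xI]])
      then show "((\<lambda>x. \<xi> (\<sigma> x)) has_derivative (\<lambda>h. h \<bullet> ((2 * \<xi>1 (\<sigma> x)) *\<^sub>R (x - c)))) (at x)"
        by (simp add: algebra_simps)
      have "\<xi>1 (\<sigma> x) * ((x - c) \<bullet> outward_normal \<Omega> x) \<le> 0"
        using S'(4)[of x] x by (auto simp: S_def \<sigma>_def)
      then show "((2 * \<xi>1 (\<sigma> x)) *\<^sub>R (x - c)) \<bullet> outward_normal \<Omega> x \<le> 0" by simp
    qed
  qed
qed

lemma paraboloid_touching:
  assumes x0: "x0 \<in> closure \<Omega>" and touch: "M - a * (norm (x0 - c))\<^sup>2 = v x0"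
    and below: "\<forall>\<^sub>F x in nhds x0. x \<in> closure \<Omega> \<longrightarrow> M - a * (norm (x - c))\<^sup>2 \<le> v x"
    and strict: "2 * real DIM(real \<times> 'b) * a < F (v x0)"
    and nor: "\<forall>\<^sub>F x in nhds x0. x \<in> frontier \<Omega> \<longrightarrow> 0 \<le> a * ((x - c) \<bullet> outward_normal \<Omega> x)"
  shows False
  by (rule radial_touching[OF x0, of "\<lambda>\<sigma>. M - a * \<sigma>" c UNIV "\<lambda>_. - a" "\<lambda>_. 0"])
    (use assms in \<open>auto intro!: derivative_eq_intros\<close>)

text \<open>For \<open>w = \<xi>(x\<^sub>1)\<close> the Laplacian is \<open>\<xi>''\<close>, and the normal derivative is \<open>\<xi>' \<nu>\<^sub>1\<close>.\<close>

lemma planar_touching: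
  assumes x0: "x0 \<in> closure \<Omega>" and touch: "\<xi> (fst x0) = v x0"
    and below: "\<forall>\<^sub>F x in nhds x0. x \<in> closure \<Omega> \<longrightarrow> \<xi> (fst x) \<le> v x"
    and I: "open I" "fst x0 \<in> I"
    and \<xi>: "\<And>z. z \<in> I \<Longrightarrow> (\<xi> has_real_derivative \<xi>1 z) (at z)"
      "\<And>z. z \<in> I \<Longrightarrow> (\<xi>1 has_real_derivative \<xi>2 z) (at z)"
      "isCont \<xi>2 (fst x0)" "\<And>z. z \<in> I \<Longrightarrow> \<xi>1 z \<ge> 0"
    and strict: "\<xi>2 (fst x0) + F (v x0) > 0"
    and nor: "\<forall>\<^sub>F x in nhds x0. x \<in> frontier \<Omega> \<longrightarrow> fst (outward_normal \<Omega> x) \<le> 0"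
  shows False
proof -
  obtain S' where S': "open S'" "x0 \<in> S'"
    "\<And>x. x \<in> S' \<Longrightarrow> x \<in> closure \<Omega> \<Longrightarrow> \<xi> (fst x) \<le> v x"
    "\<And>x. x \<in> S' \<Longrightarrow> x \<in> frontier \<Omega> \<Longrightarrow> fst (outward_normal \<Omega> x) \<le> 0"
    using eventually_conj[OF below nor] unfolding eventually_nhds by blast
  define S where "S = S' \<inter> fst -` I"
  have "open S" unfolding S_def using S'(1) I(1) by (intro open_Int open_vimage_fst)
  have "x0 \<in> S" using S' I by (simp add: S_def)
  show False
  proof (rule touching[OF x0 \<open>open S\<close> \<open>x0 \<in> S\<close>, of "\<lambda>x. \<xi> (fst x)"
        "\<lambda>x b. \<xi>2 (fst x) * (fst b * fst b)" "\<lambda>x. \<xi>2 (fst x)"])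
    show "continuous_on S (\<lambda>x. \<xi> (fst x))"
    proof -
      have "continuous_on I \<xi>"
        using \<xi>(1) by (intro continuous_at_imp_continuous_on ballI) (auto intro: DERIV_isCont)
      then show ?thesis
        by (rule continuous_on_compose2) (auto simp: S_def intro!: continuous_intros)
    qed
    show "\<xi> (fst x) \<le> v x" if "x \<in> closure \<Omega> \<inter> S" for x
      using S'(3)[of x] that by (simp add: S_def)
    show "line_deriv2 (\<lambda>x. \<xi> (fst x)) x b (\<xi>2 (fst x) * (fst b * fst b))"
      if x: "x \<in> S" for x b
    proof (rule line_deriv2I)
      have s: "((\<lambda>t. fst (x + t *\<^sub>R b)) has_real_derivative fst b) (at t)" for t
        by (auto intro!: derivative_eq_intros)
      show "\<forall>\<^sub>F t in nhds 0. ((\<lambda>t. \<xi> (fst (x + t *\<^sub>R b))) has_real_derivative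
          \<xi>1 (fst (x + t *\<^sub>R b)) * fst b) (at t)"
        using eventually_along_line[OF \<open>open S\<close> x, of b]
      proof eventually_elim
        case (elim t)
        then show ?case by (intro DERIV_chain2[OF \<xi>(1) s]) (simp add: S_def)
      qed
      have "((\<lambda>t. \<xi>1 (fst (x + t *\<^sub>R b))) has_real_derivative \<xi>2 (fst (x + 0 *\<^sub>R b)) * fst b) (at 0)"
        using x by (intro DERIV_chain2[OF \<xi>(2) s]) (simp add: S_def)
      then show "((\<lambda>t. \<xi>1 (fst (x + t *\<^sub>R b)) * fst b) has_real_derivative
          \<xi>2 (fst x) * (fst b * fst b)) (at 0)"
        by (auto intro!: derivative_eq_intros)
    qed
    show "(\<Sum>b\<in>(Basis::(real \<times> 'b) set). \<xi>2 (fst x) * (fst b * fst b)) = \<xi>2 (fst x)" for x :: "real \<times> 'b"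
    proof -
      have "(1::real, 0::'b) \<bullet> (1, 0) = (\<Sum>b\<in>Basis. ((1::real, 0::'b) \<bullet> b) * ((1::real, 0::'b) \<bullet> b))"
        by (rule euclidean_inner)
      then have "(\<Sum>b\<in>(Basis::(real \<times> 'b) set). fst b * fst b) = 1" by (simp add: inner_prod_def)
      then show ?thesis by (simp only: sum_distrib_left[symmetric] mult_1_right)
    qed
    show "isCont (\<lambda>x. \<xi>2 (fst x)) x0"
      using \<xi>(3) by (rule isCont_o2[OF isCont_fst[OF continuous_ident]])
    show "\<exists>\<gamma>. ((\<lambda>x. \<xi> (fst x)) has_derivative (\<lambda>h. h \<bullet> \<gamma>)) (at x) \<and> \<gamma> \<bullet> outward_normal \<Omega> x \<le> 0"
      if x: "x \<in> frontier \<Omega>" "x \<in> S" for x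
    proof (intro exI conjI)
      have xI: "fst x \<in> I" using x by (simp add: S_def)
      have "((\<lambda>x. \<xi> (fst x)) has_derivative (\<lambda>h. fst h * \<xi>1 (fst x))) (at x)"
        by (rule DERIV_compose_FDERIV[where f=\<xi> and g=fst and x=x,
              OF \<xi>(1)[OF xI] has_derivative_fst[OF has_derivative_ident]])
      then show "((\<lambda>x. \<xi> (fst x)) has_derivative (\<lambda>h. h \<bullet> (\<xi>1 (fst x), 0))) (at x)"
        by (simp add: inner_prod_def)
      show "(\<xi>1 (fst x), 0) \<bullet> outward_normal \<Omega> x \<le> 0"
        using \<xi>(4)[OF xI] S'(4)[of x] x by (simp add: S_def inner_prod_def mult_nonneg_nonpos)
    qed
  qed (fact touch strict)+
qed

end

section \<open>Sliding of radial and planar subsolutions\<close>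

text \<open>The parameters at which the inequality fails somewhere form the projection of a compact set. At the least
of them the inequality still holds weakly, by continuity from below, so there is a point of contact.\<close>

lemma sliding:
  fixes v :: "'a::metric_space \<Rightarrow> real" and w :: "real \<Rightarrow> 'a \<Rightarrow> real"
  assumes K: "compact K" and v: "continuous_on K v"
    and w: "continuous_on ({s0..s1} \<times> K) (\<lambda>z. w (fst z) (snd z))"
    and start: "\<And>x. x \<in> K \<Longrightarrow> w s0 x < v x"
    and no_contact: "\<And>s x. s \<in> {s0..s1} \<Longrightarrow> x \<in> K \<Longrightarrow> w s x = v x \<Longrightarrow> \<forall>y\<in>K. w s y \<le> v y \<Longrightarrow> False"
    and s: "s \<in> {s0..s1}" and x: "x \<in> K"
  shows "w s x < v x"
proof (rule ccontr)
  assume nless: "\<not> w s x < v x"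
  define d where "d z = w (fst z) (snd z) - v (snd z)" for z
  define A where "A = ({s0..s1} \<times> K) \<inter> d -` {0..}"
  have contd: "continuous_on ({s0..s1} \<times> K) d"
    unfolding d_def by (intro continuous_intros w continuous_on_compose2[OF v]) auto
  then have "closedin (top_of_set ({s0..s1} \<times> K)) A"
    unfolding A_def by (rule continuous_closedin_preimage) simp
  then have "compact A"
    using compact_Times[OF compact_Icc K] closedin_compact by blast
  moreover have "(s, x) \<in> A" using s x nless by (simp add: A_def d_def)
  ultimately obtain z where z: "z \<in> A" "\<And>z'. z' \<in> A \<Longrightarrow> fst z \<le> fst z'"
    using continuous_attains_inf[of A fst] continuous_on_fst[OF continuous_on_id] by blast
  define t y where "t = fst z" and "y = snd z"
  have t: "t \<in> {s0..s1}" "y \<in> K" "v y \<le> w t y"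
    using z(1) by (auto simp: A_def d_def t_def y_def)
  have le: "w t u \<le> v u" if u: "u \<in> K" for u
  proof (rule ccontr)
    assume "\<not> w t u \<le> v u"
    then have pos: "d (t, u) > 0" by (simp add: d_def)
    have "continuous_on {s0..t} (\<lambda>s. d (s, u))"
      using t u by (intro continuous_on_compose2[OF contd]) (auto intro!: continuous_intros)
    moreover have "d (s0, u) \<le> 0" using start[OF u] by (simp add: d_def)
    ultimately obtain r where r: "s0 \<le> r" "r \<le> t" "d (r, u) = 0"
      using IVT'[of "\<lambda>s. d (s, u)" s0 0 t] pos t by auto
    then have "(r, u) \<in> A" using t u by (simp add: A_def)
    then have "t \<le> r" using z(2) by (fastforce simp: t_def)
    then show False using r pos by simp
  qed
  show False
    using no_contact[OF t(1,2)] le t by force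
qed

text \<open>A solution together with the constants of its subsolutions. The bounds by \<open>\<kappa>\<close> make the paraboloid cap and the
decreasing tail strict subsolutions. The bounds \<open>p < 2 a r1\<close> and \<open>p < (m - m1) b\<close> say that the slope of the tail at the
junction is smaller than that of the cap, so that the kink is convex.\<close>

locale profile_solution = neumann_solution \<Omega> \<alpha> F v
  for \<Omega> :: "(real \<times> 'b::euclidean_space) set" and \<alpha> F v +
  fixes \<kappa> m1 m p P \<rho> a r1 b :: real and h h' :: "real \<Rightarrow> real" and J :: "real set"
  assumes \<kappa>: "\<kappa> > 0" and m1: "0 < m1" "m1 < m" and F_ge: "\<And>s. s \<in> {m1..m} \<Longrightarrow> \<kappa> \<le> F s"
    and h0: "h 0 = m1" and h'0: "h' 0 = - p" and \<rho>: "\<rho> > 0" "h \<rho> = 0"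
    and h: "\<And>r. (h has_real_derivative h' r) (at r)"
    and h': "\<And>r. - P \<le> h' r" "\<And>r. h' r < 0"
    and J: "open J" "{0..\<rho>} \<subseteq> J"
    and h'': "\<And>r. r \<in> J \<Longrightarrow> (h' has_real_derivative \<kappa> - F (h r)) (at r)"
    and r1: "r1 > 0" "a > 0" "a * r1\<^sup>2 = m - m1" "p < 2 * a * r1"
      "2 * real DIM(real \<times> 'b) * a < \<kappa>" "real DIM(real \<times> 'b) * P < \<kappa> * r1"
    and b: "b > 0" "p < (m - m1) * b" "(m - m1) * b\<^sup>2 < \<kappa>"
begin

lemma h_strict_decreasing: "s < t \<Longrightarrow> h t < h s"
  by (rule DERIV_neg_imp_decreasing[of s t h]) (use h h' in blast)+

lemma continuous_h: "continuous_on S h"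
  using h by (auto intro!: continuous_at_imp_continuous_on DERIV_isCont)

lemma h_nonneg_imp: "0 \<le> h r \<Longrightarrow> r \<le> \<rho>"
  using h_strict_decreasing[of \<rho> r] \<rho> by force

definition bump :: "real \<Rightarrow> real" where
  "bump r = (if r \<le> r1 then m - a * r\<^sup>2 else h (r - r1))"

definition ramp :: "real \<Rightarrow> real" where
  "ramp z = (if z \<le> 0 then h (- z) else m - (m - m1) * exp (- b * z))"

lemma bump_0: "bump 0 = m" using r1 by (simp add: bump_def)

lemma bump_le: "bump r \<le> m"
proof (cases "r \<le> r1")
  case False
  then have "h (r - r1) < h 0" by (intro h_strict_decreasing) simp
  then show ?thesis using False m1 h0 by (simp add: bump_def)
qed (use r1 in \<open>simp add: bump_def\<close>)

lemma bump_neg: "r1 + \<rho> < r \<Longrightarrow> bump r < 0"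
  using h_strict_decreasing[of \<rho> "r - r1"] \<rho> by (simp add: bump_def)

lemma continuous_bump: "continuous_on UNIV bump"
proof -
  have "continuous_on ({..r1} \<union> {r1..}) (\<lambda>r. if r \<le> r1 then m - a * r\<^sup>2 else h (r - r1))"
    by (rule continuous_on_If) (use r1 h0 in \<open>auto intro!: continuous_intros continuous_on_compose2[OF continuous_h[of UNIV]]\<close>)
  moreover have "{..r1} \<union> {r1..} = UNIV" by auto
  ultimately show ?thesis by (simp add: bump_def[abs_def])
qed

text \<open>Convexity of the kink: slightly beyond \<open>r1\<close> the tail lies above the continued cap, hence a contact at the kink is also a
contact with the smooth cap.\<close>

lemma bump_ge_cap: "\<exists>e>0. \<forall>r<r1 + e. m - a * r\<^sup>2 \<le> bump r"
proof -
  have "((\<lambda>r. h (r - r1) - (m - a * r\<^sup>2)) has_real_derivative h' (r1 - r1) * (1 - 0) - (0 - a * (2 * r1))) (at r1)"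
    by (auto intro!: derivative_eq_intros DERIV_chain2[OF h])
  moreover have "h' (r1 - r1) * (1 - 0) - (0 - a * (2 * r1)) > 0" using r1 h'0 by simp
  ultimately have "\<exists>d>0. \<forall>t>0. t < d \<longrightarrow> h (r1 - r1) - (m - a * r1\<^sup>2) < h (r1 + t - r1) - (m - a * (r1 + t)\<^sup>2)"
    by (rule DERIV_pos_inc_right)
  then obtain d where d: "d > 0"
    "\<And>t. 0 < t \<Longrightarrow> t < d \<Longrightarrow> h (r1 - r1) - (m - a * r1\<^sup>2) < h (r1 + t - r1) - (m - a * (r1 + t)\<^sup>2)"
    by blast
  have "m - a * r\<^sup>2 \<le> bump r" if "r < r1 + d" for r
    using d(2)[of "r - r1"] that r1(3) h0 by (cases "r \<le> r1") (auto simp: bump_def)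
  then show ?thesis using d(1) by blast
qed

lemma ramp_pos: "0 \<le> z \<Longrightarrow> ramp z = m - (m - m1) * exp (- b * z)"
  using h0 by (cases "z = 0") (auto simp: ramp_def)

lemma ramp_less: "ramp z < m"
proof (cases "z \<le> 0")
  case True
  then have "h (- z) \<le> h 0" using h_strict_decreasing[of 0 "- z"] by (cases "z = 0") auto
  then show ?thesis using True m1 h0 by (simp add: ramp_def)
qed (use m1 in \<open>simp add: ramp_def\<close>)

lemma ramp_neg: "z < - \<rho> \<Longrightarrow> ramp z < 0"
  using h_strict_decreasing[of \<rho> "- z"] \<rho> by (simp add: ramp_def)

lemma continuous_ramp: "continuous_on UNIV ramp"
proof -
  have "continuous_on ({..0} \<union> {0..}) (\<lambda>z. if z \<le> 0 then h (- z) else m - (m - m1) * exp (- b * z))"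
    by (rule continuous_on_If) (use h0 in \<open>auto intro!: continuous_intros continuous_on_compose2[OF continuous_h[of UNIV]]\<close>)
  moreover have "{..0} \<union> {0..} = (UNIV :: real set)" by auto
  ultimately show ?thesis by (simp add: ramp_def[abs_def])
qed

lemma ramp_ge_cap: "\<exists>e>0. \<forall>z>- e. m - (m - m1) * exp (- b * z) \<le> ramp z"
proof -
  have "((\<lambda>z. h (- z) - (m - (m - m1) * exp (- b * z))) has_real_derivative
      h' (- 0) * - 1 - (0 - (m - m1) * (exp (- b * 0) * - b))) (at 0)"
    by (auto intro!: derivative_eq_intros DERIV_chain2[OF h])
  moreover have "h' (- 0) * - 1 - (0 - (m - m1) * (exp (- b * 0) * - b)) < 0" using b h'0 by simp
  ultimately have "\<exists>d>0. \<forall>t>0. t < d \<longrightarrow> h (- 0) - (m - (m - m1) * exp (- b * 0))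
      < h (- (0 - t)) - (m - (m - m1) * exp (- b * (0 - t)))"
    by (rule DERIV_neg_dec_left)
  then obtain d where d: "d > 0" "\<And>t. 0 < t \<Longrightarrow> t < d \<Longrightarrow>
      h (- 0) - (m - (m - m1) * exp (- b * 0)) < h (- (0 - t)) - (m - (m - m1) * exp (- b * (0 - t)))"
    by blast
  have "m - (m - m1) * exp (- b * z) \<le> ramp z" if "- d < z" for z
    using d(2)[of "- z"] that h0 by (cases "0 \<le> z") (auto simp: ramp_pos ramp_def)
  then show ?thesis using d(1) by blast
qed

text \<open>At a point of contact \<open>bump\<close> is replaced by the smooth function it is made of there: the cap for \<open>r \<le> r1\<close>, the
tail otherwise. As \<open>v \<ge> 0\<close>, a contact with the tail has \<open>r \<le> r1 + \<rho>\<close>, where the equation for \<open>h\<close> holds, and the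
Laplacian of the tail plus \<open>F\<close> is \<open>\<kappa> + (N - 1) h' / r\<close>.\<close>

lemma bump_touching:
  assumes x0: "x0 \<in> closure \<Omega>" and touch: "bump (norm (x0 - c)) = v x0"
    and below: "\<forall>\<^sub>F x in nhds x0. x \<in> closure \<Omega> \<longrightarrow> bump (norm (x - c)) \<le> v x"
    and nor: "\<forall>\<^sub>F x in nhds x0. x \<in> frontier \<Omega> \<longrightarrow> 0 \<le> (x - c) \<bullet> outward_normal \<Omega> x"
  shows False
proof -
  define r where "r = norm (x0 - c)"
  have contn: "continuous_on UNIV (\<lambda>x. norm (x - c))" by (intro continuous_intros)
  show False
  proof (cases "r \<le> r1")
    case True
    obtain e where e: "e > 0" "\<And>r. r < r1 + e \<Longrightarrow> m - a * r\<^sup>2 \<le> bump r"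
      using bump_ge_cap by blast
    have "\<forall>\<^sub>F x in nhds x0. x \<in> {x. norm (x - c) < r1 + e}"
      using True e by (intro eventually_nhds_in_open open_Collect_less contn) (auto simp: r_def)
    with below have below': "\<forall>\<^sub>F x in nhds x0. x \<in> closure \<Omega> \<longrightarrow> m - a * (norm (x - c))\<^sup>2 \<le> v x"
      by eventually_elim (use e(2) in \<open>force intro: order_trans\<close>)
    have v0: "v x0 = m - a * r\<^sup>2" using touch True by (simp add: bump_def r_def)
    have "r\<^sup>2 \<le> r1\<^sup>2" using True by (intro power_mono) (auto simp: r_def)
    then have "a * r\<^sup>2 \<le> a * r1\<^sup>2" using r1(2) by (intro mult_left_mono) auto
    moreover have "0 \<le> a * r\<^sup>2" using r1(2) by simp
    ultimately have "\<kappa> \<le> F (v x0)" using r1(3) by (intro F_ge) (auto simp: v0)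
    then show False
      using nor r1 by (intro paraboloid_touching[OF x0, of m a c] below')
        (auto simp: v0 r_def elim: eventually_mono)
  next
    case False
    define \<xi> where "\<xi> \<sigma> = h (sqrt \<sigma> - r1)" for \<sigma>
    define \<xi>1 where "\<xi>1 \<sigma> = h' (sqrt \<sigma> - r1) * (inverse (sqrt \<sigma>) / 2)" for \<sigma>
    define \<xi>2 where "\<xi>2 \<sigma> = (\<kappa> - F (h (sqrt \<sigma> - r1))) / (4 * \<sigma>) - h' (sqrt \<sigma> - r1) / (4 * \<sigma> * sqrt \<sigma>)" for \<sigma>
    define I where "I = {r1\<^sup>2<..} \<inter> (\<lambda>\<sigma>. sqrt \<sigma> - r1) -` J"
    have rpos: "r > 0" "r > r1" using False r1 by auto
    have v0: "v x0 = h (r - r1)" using touch False by (simp add: bump_def r_def)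
    have "r - r1 \<le> \<rho>" using nonneg[OF x0] by (intro h_nonneg_imp) (simp add: v0)
    then have rJ: "r - r1 \<in> J" using J rpos by auto
    have Ipos: "\<sigma> > 0" if "\<sigma> \<in> I" for \<sigma>
      using that by (auto simp: I_def intro: le_less_trans[OF zero_le_power2])
    have sq: "sqrt (r\<^sup>2) = r" using rpos by simp
    have "open ((\<lambda>\<sigma>. sqrt \<sigma> - r1) -` J)"
      using J(1) by (intro open_vimage) (auto intro!: continuous_intros)
    then have "open I" unfolding I_def by (intro open_Int) auto
    have rI: "r\<^sup>2 \<in> I" using rJ rpos r1 by (auto simp: I_def intro!: power_strict_mono)
    have ds: "((\<lambda>\<sigma>. sqrt \<sigma> - r1) has_real_derivative inverse (sqrt \<sigma>) / 2) (at \<sigma>)" if "\<sigma> > 0" for \<sigma>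
      using that by (auto intro!: derivative_eq_intros)
    have nor': "\<forall>\<^sub>F x in nhds x0. x \<in> frontier \<Omega> \<longrightarrow>
        \<xi>1 ((norm (x - c))\<^sup>2) * ((x - c) \<bullet> outward_normal \<Omega> x) \<le> 0"
      using nor
    proof eventually_elim
      case (elim x)
      have "\<xi>1 ((norm (x - c))\<^sup>2) \<le> 0"
        using h'(2)[of "norm (x - c) - r1"] by (auto simp: \<xi>1_def intro!: mult_nonpos_nonneg)
      then show ?case using elim by (auto intro: mult_nonpos_nonneg)
    qed
    have "\<forall>\<^sub>F x in nhds x0. x \<in> {x. r1 < norm (x - c)}"
      using False by (intro eventually_nhds_in_open open_Collect_less contn) (auto simp: r_def)
    with below have below': "\<forall>\<^sub>F x in nhds x0. x \<in> closure \<Omega> \<longrightarrow> \<xi> ((norm (x - c))\<^sup>2) \<le> v x"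
      by eventually_elim (auto simp: \<xi>_def bump_def)
    show False
    proof (rule radial_touching[OF x0 _ below' \<open>open I\<close> _ _ _ _ _ nor'])
      show "\<xi> ((norm (x0 - c))\<^sup>2) = v x0" by (simp add: \<xi>_def v0 r_def)
      show "(norm (x0 - c))\<^sup>2 \<in> I" using rI by (simp add: r_def)
      show "(\<xi> has_real_derivative \<xi>1 \<sigma>) (at \<sigma>)" if "\<sigma> \<in> I" for \<sigma>
        unfolding \<xi>_def \<xi>1_def by (rule DERIV_chain2[OF h ds[OF Ipos[OF that]]])
      show "(\<xi>1 has_real_derivative \<xi>2 \<sigma>) (at \<sigma>)" if \<sigma>: "\<sigma> \<in> I" for \<sigma>
      proof -
        have "((\<lambda>\<sigma>. h' (sqrt \<sigma> - r1)) has_real_derivative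
            (\<kappa> - F (h (sqrt \<sigma> - r1))) * (inverse (sqrt \<sigma>) / 2)) (at \<sigma>)"
          using \<sigma> by (intro DERIV_chain2[OF h'' ds[OF Ipos[OF \<sigma>]]]) (simp add: I_def)
        moreover have "((\<lambda>\<sigma>. inverse (sqrt \<sigma>) / 2) has_real_derivative
            - (1 / (4 * \<sigma> * sqrt \<sigma>))) (at \<sigma>)"
          using Ipos[OF \<sigma>] by (auto intro!: derivative_eq_intros simp: field_simps power2_eq_square)
        ultimately have "(\<xi>1 has_real_derivative
            (\<kappa> - F (h (sqrt \<sigma> - r1))) * (inverse (sqrt \<sigma>) / 2) * (inverse (sqrt \<sigma>) / 2)
            + - (1 / (4 * \<sigma> * sqrt \<sigma>)) * h' (sqrt \<sigma> - r1)) (at \<sigma>)"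
          unfolding \<xi>1_def by (rule DERIV_mult)
        moreover have "inverse (sqrt \<sigma>) / 2 * (inverse (sqrt \<sigma>) / 2) = 1 / (4 * \<sigma>)"
          using Ipos[OF \<sigma>] by (simp add: field_simps)
        ultimately show ?thesis by (simp add: \<xi>2_def mult.assoc mult.commute[of \<sigma> 4])
      qed
      show "isCont \<xi>2 ((norm (x0 - c))\<^sup>2)"
      proof -
        have 1: "isCont (\<lambda>\<sigma>. sqrt \<sigma> - r1) (r\<^sup>2)" by (intro continuous_intros)
        have 2: "isCont h' (sqrt (r\<^sup>2) - r1)" unfolding sq by (rule DERIV_isCont[OF h''[OF rJ]])
        have 3: "isCont h (sqrt (r\<^sup>2) - r1)" by (rule DERIV_isCont[OF h])
        have 4: "isCont F (h (sqrt (r\<^sup>2) - r1))" using cont_F by (simp add: continuous_on_eq_continuous_at)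
        have "isCont (\<lambda>\<sigma>. F (h (sqrt \<sigma> - r1))) (r\<^sup>2)"
          by (rule isCont_o2[OF isCont_o2[OF 1 3] 4])
        moreover have "isCont (\<lambda>\<sigma>. h' (sqrt \<sigma> - r1)) (r\<^sup>2)"
          by (rule isCont_o2[OF 1 2])
        ultimately have "isCont \<xi>2 (r\<^sup>2)"
          unfolding \<xi>2_def[abs_def] using rpos by (intro continuous_intros) auto
        then show ?thesis by (simp add: r_def)
      qed
      have "4 * r\<^sup>2 * \<xi>2 (r\<^sup>2) = \<kappa> - F (h (r - r1)) - h' (r - r1) / r"
        unfolding \<xi>2_def sq using rpos by (simp add: field_simps power2_eq_square)
      moreover have "2 * real DIM(real \<times> 'b) * \<xi>1 (r\<^sup>2) = real DIM(real \<times> 'b) * h' (r - r1) / r"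
        unfolding \<xi>1_def sq using rpos by (simp add: field_simps)
      moreover have "- h' (r - r1) / r > 0" using h'(2)[of "r - r1"] rpos by (simp add: divide_neg_pos)
      moreover have "\<kappa> + real DIM(real \<times> 'b) * h' (r - r1) / r > 0"
      proof -
        have "real DIM(real \<times> 'b) * - h' (r - r1) \<le> real DIM(real \<times> 'b) * P"
          using h'(1)[of "r - r1"] by (intro mult_left_mono) auto
        also have "\<dots> < \<kappa> * r1" by (rule r1)
        also have "\<dots> < \<kappa> * r" using \<kappa> rpos by simp
        finally show ?thesis using rpos by (simp add: field_simps)
      qed
      ultimately have "4 * r\<^sup>2 * \<xi>2 (r\<^sup>2) + 2 * real DIM(real \<times> 'b) * \<xi>1 (r\<^sup>2) + F (v x0) > 0"
        unfolding v0 by linarith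
      then show "4 * (norm (x0 - c))\<^sup>2 * \<xi>2 ((norm (x0 - c))\<^sup>2)
          + 2 * real DIM(real \<times> 'b) * \<xi>1 ((norm (x0 - c))\<^sup>2) + F (v x0) > 0"
        by (simp only: r_def)
    qed
  qed
qed

text \<open>As for \<open>bump\<close>, with the exponential cap for \<open>z \<ge> 0\<close>. The second derivative of this cap is at least
\<open>- (m - m1) b\<^sup>2 > - \<kappa>\<close>.\<close>

lemma ramp_touching:
  assumes x0: "x0 \<in> closure \<Omega>" and touch: "ramp (fst x0 + s) = v x0"
    and below: "\<forall>\<^sub>F x in nhds x0. x \<in> closure \<Omega> \<longrightarrow> ramp (fst x + s) \<le> v x"
    and nor: "\<forall>\<^sub>F x in nhds x0. x \<in> frontier \<Omega> \<longrightarrow> fst (outward_normal \<Omega> x) \<le> 0"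
  shows False
proof -
  define z where "z = fst x0 + s"
  have contn: "continuous_on UNIV (\<lambda>x::real \<times> 'b. fst x + s)" by (intro continuous_intros)
  show False
  proof (cases "0 \<le> z")
    case True
    obtain e where e: "e > 0" "\<And>z. - e < z \<Longrightarrow> m - (m - m1) * exp (- b * z) \<le> ramp z"
      using ramp_ge_cap by blast
    have "\<forall>\<^sub>F x in nhds x0. x \<in> {x. - e < fst x + s}"
      using True e by (intro eventually_nhds_in_open open_Collect_less contn) (auto simp: z_def)
    with below have below': "\<forall>\<^sub>F x in nhds x0. x \<in> closure \<Omega> \<longrightarrow>
        m - (m - m1) * exp (- b * (fst x + s)) \<le> v x"
      by eventually_elim (use e(2) in \<open>force intro: order_trans\<close>)
    have v0: "v x0 = m - (m - m1) * exp (- b * z)" using touch True by (simp add: ramp_pos z_def)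
    have ex: "exp (- b * z) \<le> 1" using True b by simp
    then have "(m - m1) * exp (- b * z) \<le> (m - m1) * 1" using m1 by (intro mult_left_mono) auto
    moreover have "(m - m1) * exp (- b * z) \<ge> 0" using m1 by simp
    ultimately have Fv: "\<kappa> \<le> F (v x0)" by (intro F_ge) (auto simp: v0)
    have "(m - m1) * b\<^sup>2 * exp (- b * z) \<le> (m - m1) * b\<^sup>2 * 1" using ex m1 by (intro mult_left_mono) auto
    then have strict: "- ((m - m1) * b\<^sup>2 * exp (- b * z)) + F (v x0) > 0" using b(3) Fv by linarith
    show False
    proof (rule planar_touching[OF x0, of "\<lambda>y. m - (m - m1) * exp (- b * (y + s))" UNIV
          "\<lambda>y. (m - m1) * b * exp (- b * (y + s))" "\<lambda>y. - ((m - m1) * b\<^sup>2 * exp (- b * (y + s)))"])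
      show "((\<lambda>y. m - (m - m1) * exp (- b * (y + s))) has_real_derivative
          (m - m1) * b * exp (- b * (y + s))) (at y)" for y
        by (auto intro!: derivative_eq_intros)
      show "((\<lambda>y. (m - m1) * b * exp (- b * (y + s))) has_real_derivative
          - ((m - m1) * b\<^sup>2 * exp (- b * (y + s)))) (at y)" for y
        by (auto intro!: derivative_eq_intros simp: power2_eq_square)
      show "isCont (\<lambda>y. - ((m - m1) * b\<^sup>2 * exp (- b * (y + s)))) (fst x0)"
        by (intro continuous_intros)
    qed (use below' nor strict v0 m1 b in \<open>auto simp: z_def\<close>)
  next
    case False
    define I where "I = {..<- s} \<inter> (\<lambda>y. - (y + s)) -` J"
    have v0: "v x0 = h (- z)" using touch False by (simp add: ramp_def z_def)
    have "- z \<le> \<rho>" using nonneg[OF x0] by (intro h_nonneg_imp) (simp add: v0)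
    then have zJ: "- z \<in> J" using J False by auto
    have "open ((\<lambda>y. - (y + s)) -` J)"
      using J(1) by (intro open_vimage) (auto intro!: continuous_intros)
    then have "open I" unfolding I_def by (intro open_Int) auto
    have "\<forall>\<^sub>F x in nhds x0. x \<in> {x. fst x + s < 0}"
      using False by (intro eventually_nhds_in_open open_Collect_less contn) (auto simp: z_def)
    with below have below': "\<forall>\<^sub>F x in nhds x0. x \<in> closure \<Omega> \<longrightarrow> h (- (fst x + s)) \<le> v x"
      by eventually_elim (auto simp: ramp_def)
    have ds: "((\<lambda>y. - (y + s)) has_real_derivative - 1) (at y)" for y
      by (auto intro!: derivative_eq_intros)
    show False
    proof (rule planar_touching[OF x0 _ below' \<open>open I\<close> _ _ _ _ _ _ nor,
          of "\<lambda>y. - h' (- (y + s))" "\<lambda>y. \<kappa> - F (h (- (y + s)))"])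
      show "((\<lambda>y. h (- (y + s))) has_real_derivative - h' (- (y + s))) (at y)" for y
        using DERIV_chain2[OF h ds, of y] by simp
      show "((\<lambda>y. - h' (- (y + s))) has_real_derivative \<kappa> - F (h (- (y + s)))) (at y)" if "y \<in> I" for y
        using DERIV_minus[OF DERIV_chain2[OF h'' ds, of y]] that by (simp add: I_def)
      show "isCont (\<lambda>y. \<kappa> - F (h (- (y + s)))) (fst x0)"
      proof -
        have 1: "isCont (\<lambda>y. - (y + s)) (fst x0)" by (intro continuous_intros)
        have "isCont F (h (- (fst x0 + s)))" using cont_F by (simp add: continuous_on_eq_continuous_at)
        then have "isCont (\<lambda>y. F (h (- (y + s)))) (fst x0)"
          by (rule isCont_o2[OF isCont_o2[OF 1 DERIV_isCont[OF h]]])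
        then show ?thesis by (intro continuous_intros)
      qed
      show "0 \<le> - h' (- (y + s))" for y using h'(2)[of "- (y + s)"] by simp
      show "\<kappa> - F (h (- (fst x0 + s))) + F (v x0) > 0" using \<kappa> by (simp add: v0 z_def)
    qed (use zJ False v0 in \<open>auto simp: I_def z_def\<close>)
  qed
qed

text \<open>The hypothesis on the normals concerns only boundary points within distance \<open>R\<close> of the moving centre, slightly more than the
radius of the ball where \<open>bump \<ge> 0\<close>: outside of that ball \<open>bump < 0 \<le> v\<close> and there is no contact.\<close>

lemma bump_sliding:
  assumes R: "r1 + \<rho> < R"
    and nor: "\<And>s x. s \<in> {0..1} \<Longrightarrow> x \<in> frontier \<Omega> \<Longrightarrow> norm (x - (c0 + s *\<^sub>R (c1 - c0))) < R \<Longrightarrow>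
      0 \<le> (x - (c0 + s *\<^sub>R (c1 - c0))) \<bullet> outward_normal \<Omega> x"
    and start: "\<And>x. x \<in> closure \<Omega> \<Longrightarrow> bump (norm (x - c0)) < v x"
    and x: "x \<in> closure \<Omega>"
  shows "bump (norm (x - c1)) < v x"
proof (cases "norm (x - c1) \<le> r1 + \<rho>")
  case False
  then show ?thesis using bump_neg[of "norm (x - c1)"] nonneg[OF x] by simp
next
  case True
  define c where "c s = c0 + s *\<^sub>R (c1 - c0)" for s
  define B where "B = norm c0 + norm c1 + r1 + \<rho>"
  have normc: "norm (c s) \<le> norm c0 + norm c1" if "s \<in> {0..1}" for s
  proof -
    have "c s = (1 - s) *\<^sub>R c0 + s *\<^sub>R c1" by (simp add: c_def algebra_simps)
    then have "norm (c s) \<le> (1 - s) * norm c0 + s * norm c1"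
      using norm_triangle_ineq[of "(1 - s) *\<^sub>R c0" "s *\<^sub>R c1"] that by simp
    also have "\<dots> \<le> 1 * norm c0 + 1 * norm c1"
      using that by (intro add_mono mult_right_mono) auto
    finally show ?thesis by simp
  qed
  have far: "norm y \<le> B" if "norm (y - c s) \<le> r1 + \<rho>" "s \<in> {0..1}" for y s
    using norm_triangle_ineq[of "y - c s" "c s"] normc[OF that(2)] that(1) by (simp add: B_def)
  define K where "K = closure \<Omega> \<inter> cball 0 (B + 1)"
  have "bump (norm (x - c 1)) < v x"
  proof (rule sliding[of K v 0 1 "\<lambda>s x. bump (norm (x - c s))"])
    show "compact K" unfolding K_def by (intro closed_Int_compact) auto
    show "continuous_on K v" by (rule continuous_on_subset[OF cont_v]) (simp add: K_def)
    show "continuous_on ({0..1} \<times> K) (\<lambda>z. bump (norm (snd z - c (fst z))))"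
      unfolding c_def by (rule continuous_on_compose2[OF continuous_bump]) (auto intro!: continuous_intros)
    show "bump (norm (y - c 0)) < v y" if "y \<in> K" for y
      using start[of y] that by (simp add: c_def K_def)
    show "x \<in> K" using x far[of x 1] True by (simp add: K_def c_def)
    fix s y assume s: "s \<in> {0..1}" and y: "y \<in> K" and touch: "bump (norm (y - c s)) = v y"
      and le: "\<forall>y\<in>K. bump (norm (y - c s)) \<le> v y"
    have ycl: "y \<in> closure \<Omega>" using y by (simp add: K_def)
    have near: "norm (y - c s) \<le> r1 + \<rho>"
      using bump_neg[of "norm (y - c s)"] touch nonneg[OF ycl] by force
    have contn: "continuous_on UNIV (\<lambda>x. norm (x - c s))" by (intro continuous_intros)
    have "\<forall>\<^sub>F x in nhds y. x \<in> {x. norm (x - c s) < R}"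
      using near R by (intro eventually_nhds_in_open open_Collect_less contn) auto
    then have 1: "\<forall>\<^sub>F x in nhds y. x \<in> frontier \<Omega> \<longrightarrow> 0 \<le> (x - c s) \<bullet> outward_normal \<Omega> x"
      by eventually_elim (use nor[OF s] in \<open>auto simp: c_def\<close>)
    have "\<forall>\<^sub>F x in nhds y. x \<in> ball 0 (B + 1)"
      using far[OF near s] by (intro eventually_nhds_in_open) auto
    then have 2: "\<forall>\<^sub>F x in nhds y. x \<in> closure \<Omega> \<longrightarrow> bump (norm (x - c s)) \<le> v x"
      by eventually_elim (use le in \<open>auto simp: K_def\<close>)
    show False by (rule bump_touching[OF ycl touch 2 1])
  qed auto
  then show ?thesis by (simp add: c_def)
qed

end

section \<open>Solutions in domains with a convex end\<close>

lemma compact_slice: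
  fixes \<Omega> :: "(real \<times> 'b::euclidean_space) set"
  assumes sub: "{x \<in> \<Omega>. fst x < U} \<subseteq> UNIV \<times> ball 0 C" and B: "B < U"
  shows "compact (closure \<Omega> \<inter> {x. A \<le> fst x \<and> fst x \<le> B})"
proof -
  have "closure \<Omega> \<inter> {x. fst x < U} \<subseteq> closure (\<Omega> \<inter> {x. fst x < U})"
    using open_Int_closure_subset[of "{x. fst x < U}" \<Omega>]
    by (simp add: Int_commute open_Collect_less continuous_on_fst continuous_on_id)
  also have "\<dots> \<subseteq> closure (UNIV \<times> cball 0 C)"
    by (rule closure_mono) (use sub ball_subset_cball[of 0 C] in \<open>auto simp: mem_Times_iff\<close>)
  also have "\<dots> = UNIV \<times> cball 0 C" by (intro closure_closed closed_Times) auto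
  finally have cl: "closure \<Omega> \<inter> {x. fst x < U} \<subseteq> UNIV \<times> cball 0 C" .
  have "closure \<Omega> \<inter> {x. A \<le> fst x \<and> fst x \<le> B} = closure \<Omega> \<inter> ({A..B} \<times> cball 0 C)"
    (is "?S = ?T")
  proof
    show "?S \<subseteq> ?T"
    proof
      fix x assume x: "x \<in> ?S"
      then have "x \<in> UNIV \<times> cball 0 C" using B by (intro subsetD[OF cl]) simp
      then show "x \<in> ?T" using x by (simp add: mem_Times_iff)
    qed
  qed auto
  then show ?thesis
    by (simp add: closed_Int_compact compact_Times)
qed

text \<open>A supporting hyperplane property at boundary points of a set that is convex only within \<open>H\<close>. If the derivative of
the defining function in the direction \<open>z - x\<close> were positive, the segment from \<open>x\<close> to \<open>z\<close> would leave
the closure of \<open>\<Omega>\<close> immediately, although it lies in the closure of the convex part.\<close>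

lemma convex_outward_normal:
  fixes \<Omega> :: "(real \<times> 'b::euclidean_space) set"
  assumes dom: "uniformly_C2_holder_domain \<alpha> \<Omega>" and H: "open H" and conv: "convex (\<Omega> \<inter> H)"
    and z: "z \<in> \<Omega> \<inter> H" and x: "x \<in> frontier \<Omega>" "x \<in> H"
  shows "0 \<le> (x - z) \<bullet> outward_normal \<Omega> x"
proof -
  have "is_outward_normal \<Omega> x (outward_normal \<Omega> x)"
    using dom x(1) by (rule is_outward_normal_outward_normal)
  then obtain U g G where U: "open U" "x \<in> U" and g: "\<And>y. y \<in> U \<Longrightarrow> GDERIV g y :> G y" "g x = 0"
    and \<Omega>U: "\<Omega> \<inter> U = {y \<in> U. g y < 0}" and \<nu>: "outward_normal \<Omega> x = G x /\<^sub>R norm (G x)"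
    unfolding is_outward_normal_def by blast
  have contg: "continuous_on U g"
    using g(1) by (auto simp: gderiv_def intro!: continuous_at_imp_continuous_on has_derivative_continuous)
  have gle: "g y \<le> 0" if y: "y \<in> U" "y \<in> closure \<Omega>" for y
  proof (rule ccontr)
    assume "\<not> g y \<le> 0"
    then have "y \<in> U \<inter> g -` {0<..}" using y by simp
    moreover have "open (U \<inter> g -` {0<..})"
      by (intro continuous_open_preimage contg U) auto
    ultimately have "\<Omega> \<inter> (U \<inter> g -` {0<..}) \<noteq> {}"
      using y(2) unfolding closure_iff_nhds_not_empty by blast
    then show False using \<Omega>U by force
  qed
  have "x \<in> closure (\<Omega> \<inter> H)"
    using open_Int_closure_subset[OF H, of \<Omega>] x by (auto simp: frontier_def Int_commute)
  moreover have "z \<in> closure (\<Omega> \<inter> H)" using z closure_subset by blast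
  ultimately have seg: "x + t *\<^sub>R (z - x) \<in> closure (\<Omega> \<inter> H)" if "0 \<le> t" "t \<le> 1" for t
    using convexD_alt[OF convex_closure[OF conv], of x z t] that by (simp add: algebra_simps)
  have cl: "x + t *\<^sub>R (z - x) \<in> closure \<Omega>" if "0 \<le> t" "t \<le> 1" for t
    using seg[OF that] closure_mono[of "\<Omega> \<inter> H" \<Omega>] by blast
  have "(z - x) \<bullet> G x \<le> 0"
  proof (rule ccontr)
    assume "\<not> (z - x) \<bullet> G x \<le> 0"
    then have pos: "(z - x) \<bullet> G x > 0" by simp
    have "(g has_derivative (\<lambda>h. h \<bullet> G x)) (at x)" using g(1)[OF U(2)] by (simp add: gderiv_def)
    then have "((\<lambda>t. g (x + t *\<^sub>R (z - x))) has_real_derivative (z - x) \<bullet> G x) (at 0)"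
      using DERIV_along_line[of g "\<lambda>h. h \<bullet> G x" x 0 "z - x"] by simp
    from DERIV_pos_inc_right[OF this pos] obtain d where
      d: "d > 0" "\<And>t. 0 < t \<Longrightarrow> t < d \<Longrightarrow> 0 < g (x + t *\<^sub>R (z - x))" using g(2) by auto
    obtain e where e: "e > 0" "\<And>t. \<bar>t\<bar> < e \<Longrightarrow> x + t *\<^sub>R (z - x) \<in> U"
      using eventually_along_line[OF U, of "z - x"] unfolding eventually_nhds_metric dist_real_def by auto
    define t where "t = min 1 (min d e) / 2"
    have t: "0 < t" "t < d" "t < e" "t \<le> 1" using d e by (auto simp: t_def)
    show False using gle[OF e(2)[of t] cl[of t]] d(2)[of t] t by simp
  qed
  then have "(x - z) \<bullet> G x \<ge> 0" by (simp add: inner_diff_left)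
  then show ?thesis by (simp add: \<nu>)
qed

context neumann_solution begin

lemma lower_bound_closure:
  assumes low: "\<And>y. y \<in> \<Omega> \<Longrightarrow> B < fst y \<Longrightarrow> k \<le> v y"
    and x: "x \<in> closure \<Omega>" "B < fst x"
  shows "k \<le> v x"
proof -
  obtain y where y: "\<And>n. y n \<in> \<Omega>" "y \<longlonglongrightarrow> x" using x(1) unfolding closure_sequential by blast
  have "y n \<in> closure \<Omega>" for n using y(1) by (rule subsetD[OF closure_subset])
  then have "(\<lambda>n. v (y n)) \<longlonglongrightarrow> v x"
    by (intro continuous_on_tendsto_compose[OF cont_v y(2) x(1)] always_eventually allI)
  moreover have "\<forall>\<^sub>F n in sequentially. B < fst (y n)"
    using tendsto_fst[OF y(2)] x(2) by (rule order_tendstoD)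
  then have "\<forall>\<^sub>F n in sequentially. k \<le> v (y n)"
    by eventually_elim (use low y(1) in auto)
  ultimately show ?thesis by (rule tendsto_lowerbound) simp
qed

end

context profile_solution begin

text \<open>The bump travels through the inner cylinder and the convex part beyond \<open>L\<close>;
the ramp uses the sign of \<open>\<nu>\<^sub>1\<close> for \<open>x\<^sub>1 < L + R\<close> and the compactness coming from the bound \<open>C\<close>; the penalization
\<open>d \<bar>x - y\<bar>\<^sup>2\<close> uses convexity again. A number \<open>R2\<close> strictly between \<open>r1 + \<rho>\<close> and \<open>R\<close> leaves room for a
neighbourhood of each contact point.\<close>

lemma solution_eq_1:
  assumes m: "m < 1" and F_pos: "\<And>s. m1 \<le> s \<Longrightarrow> s < 1 \<Longrightarrow> 0 < F s"
    and le1: "\<And>x. x \<in> closure \<Omega> \<Longrightarrow> v x \<le> 1"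
    and lim: "\<And>k. k < 1 \<Longrightarrow> \<exists>A. \<forall>x\<in>closure \<Omega>. fst x \<le> A \<longrightarrow> k < v x"
    and R: "r1 + \<rho> < R" and cyl: "UNIV \<times> ball 0 R \<subseteq> \<Omega>"
    and conv: "convex {x \<in> \<Omega>. fst x > L}"
    and bdd: "{x \<in> \<Omega>. fst x < L + R} \<subseteq> UNIV \<times> ball 0 C"
    and widening: "\<And>x. x \<in> frontier \<Omega> \<Longrightarrow> fst x < L + R \<Longrightarrow> fst (outward_normal \<Omega> x) \<le> 0"
    and x: "x \<in> \<Omega>"
  shows "v x = 1"
proof (rule ccontr)
  assume "v x \<noteq> 1"
  have sub: "\<Omega> \<subseteq> closure \<Omega>" by (rule closure_subset)
  then have vx: "v x < 1" using le1[of x] x \<open>v x \<noteq> 1\<close> by force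
  define R0 where "R0 = r1 + \<rho>"
  have R0: "0 < R0" "R0 < R" using r1 \<rho> R by (auto simp: R0_def)
  obtain R2 where R2: "R0 < R2" "R2 < R" using dense[OF R0(2)] by blast
  have H: "open {x :: real \<times> 'b. L < fst x}" by (intro open_Collect_less continuous_intros)
  have QH: "{x \<in> \<Omega>. fst x > L} = \<Omega> \<inter> {x. L < fst x}" by auto
  have convH: "convex (\<Omega> \<inter> {x. L < fst x})" using conv unfolding QH .
  have normal: "0 \<le> (y - z) \<bullet> outward_normal \<Omega> y"
    if "z \<in> \<Omega>" "L < fst z" "y \<in> frontier \<Omega>" "L < fst y" for y z
    by (rule convex_outward_normal[OF dom H convH]) (use that in auto)
  have fstn: "\<bar>fst y - fst z\<bar> \<le> norm (y - z)" and sndn: "norm (snd y - snd z) \<le> norm (y - z)"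
    for y z :: "real \<times> 'b"
    using norm_fst_le[of "fst (y - z)" "snd (y - z)"] norm_snd_le[of "snd (y - z)" "fst (y - z)"]
    by (cases y; cases z; simp)+
  obtain A where "\<forall>x\<in>closure \<Omega>. fst x \<le> A \<longrightarrow> m < v x" using lim[OF m] ..
  then have A: "m < v x" if "x \<in> closure \<Omega>" "fst x \<le> A" for x using that by blast
  have right: "m < v y" if y: "y \<in> \<Omega>" "L + R0 < fst y" for y
  proof -
    \<comment> \<open>Within distance \<open>R0\<close> of \<open>c0\<close> one has \<open>x\<^sub>1 \<le> A\<close>, hence \<open>v > m\<close>. The path runs along the axis from \<open>c0\<close> to
      \<open>c1\<close>, and then at fixed first coordinate from \<open>c1\<close> to \<open>y\<close>.\<close>
    define c0 where "c0 = (A - R0, 0 :: 'b)"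
    define c1 where "c1 = (fst y, 0 :: 'b)"
    have "c1 \<in> UNIV \<times> ball 0 R" using R0 by (simp add: c1_def)
    then have c1: "c1 \<in> \<Omega>" "L < fst c1" using cyl R0 y(2) by (blast, simp add: c1_def)
    have start: "bump (norm (x - c0)) < v x" if "x \<in> closure \<Omega>" for x
    proof (cases "norm (x - c0) \<le> R0")
      case True
      then have "fst x \<le> A" using fstn[of x c0] by (simp add: c0_def)
      then have "m < v x" using A that by blast
      then show ?thesis using bump_le[of "norm (x - c0)"] by linarith
    next
      case False
      then show ?thesis using bump_neg[of "norm (x - c0)"] nonneg[OF that] by (simp add: R0_def)
    qed
    have mid: "bump (norm (x - c1)) < v x" if "x \<in> closure \<Omega>" for x
    proof (rule bump_sliding[OF R _ start that])
      fix s x assume "s \<in> {0..1::real}" and x: "x \<in> frontier \<Omega>" "norm (x - (c0 + s *\<^sub>R (c1 - c0))) < R"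
      have "norm (snd x) \<le> norm (x - (c0 + s *\<^sub>R (c1 - c0)))"
        using sndn[of x "c0 + s *\<^sub>R (c1 - c0)"] by (simp add: c0_def c1_def)
      then have "x \<in> UNIV \<times> ball 0 R" using x(2) by (auto simp: mem_Times_iff)
      then have "x \<in> \<Omega>" using cyl by blast
      then have False using x(1) open_domain by (simp add: frontier_def interior_open)
      then show "0 \<le> (x - (c0 + s *\<^sub>R (c1 - c0))) \<bullet> outward_normal \<Omega> x" ..
    qed
    have "bump (norm (y - y)) < v y"
    proof (rule bump_sliding[of "fst y - L" c1 y, OF _ _ mid])
      show "r1 + \<rho> < fst y - L" using y(2) by (simp add: R0_def)
      fix s x assume s: "s \<in> {0..1::real}"
        and x: "x \<in> frontier \<Omega>" "norm (x - (c1 + s *\<^sub>R (y - c1))) < fst y - L"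
      have "c1 + s *\<^sub>R (y - c1) \<in> \<Omega> \<inter> {x. L < fst x}"
        using convexD_alt[OF convH, of c1 y s] c1 y s R0 by (simp add: algebra_simps)
      moreover have "L < fst x"
        using fstn[of x "c1 + s *\<^sub>R (y - c1)"] x(2) by (simp add: c1_def)
      ultimately show "0 \<le> (x - (c1 + s *\<^sub>R (y - c1))) \<bullet> outward_normal \<Omega> x"
        using normal x(1) by blast
    qed (use y sub in blast)+
    then show ?thesis by (simp add: bump_0)
  qed
  have right': "m \<le> v y" if "y \<in> closure \<Omega>" "L + R0 < fst y" for y
  proof (rule lower_bound_closure[OF _ that])
    show "m \<le> v z" if "z \<in> \<Omega>" "L + R0 < fst z" for z
      using right[OF that] by simp
  qed
  have slice: "compact (closure \<Omega> \<inter> {x. A \<le> fst x \<and> fst x \<le> L + R2})" for A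
    using bdd by (rule compact_slice) (use R2 in simp)
  have all_m: "m \<le> v y" if y: "y \<in> closure \<Omega>" for y
  proof (cases "A \<le> fst y \<and> fst y \<le> L + R2")
    case False
    then consider "fst y \<le> A" | "L + R0 < fst y" using R2(1) by linarith
    then show ?thesis
    proof cases
      case 1
      show ?thesis using A[OF y 1] by simp
    next
      case 2
      show ?thesis by (rule right'[OF y 2])
    qed
  next
    case True
    define K where "K = closure \<Omega> \<inter> {x. A \<le> fst x \<and> fst x \<le> L + R2}"
    have below: "ramp (fst y + s) < v y" for s
    proof -
      \<comment> \<open>At the parameter \<open>s0\<close> the ramp is negative on all of \<open>K\<close>.\<close>
      define s0 where "s0 = min s (- (L + R2) - \<rho> - 1)"
      show ?thesis
      proof (rule sliding[of K v s0 s "\<lambda>s x. ramp (fst x + s)"])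
        show "compact K" unfolding K_def by (rule slice)
        show "continuous_on K v" by (rule continuous_on_subset[OF cont_v]) (simp add: K_def)
        show "continuous_on ({s0..s} \<times> K) (\<lambda>z. ramp (fst (snd z) + fst z))"
          by (rule continuous_on_compose2[OF continuous_ramp]) (auto intro!: continuous_intros)
        show "ramp (fst x + s0) < v x" if "x \<in> K" for x
        proof -
          have "fst x + s0 < - \<rho>" using that by (auto simp: K_def s0_def)
          then have "ramp (fst x + s0) < 0" by (rule ramp_neg)
          then show ?thesis using nonneg[of x] that by (simp add: K_def)
        qed
        show "s \<in> {s0..s}" by (simp add: s0_def)
        show "y \<in> K" using y True by (simp add: K_def)
        fix t x assume x: "x \<in> K" and touch: "ramp (fst x + t) = v x"
          and le: "\<forall>y\<in>K. ramp (fst y + t) \<le> v y"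
        have xcl: "x \<in> closure \<Omega>" using x by (simp add: K_def)
        have vm: "v x < m" using ramp_less[of "fst x + t"] touch by simp
        have "A < fst x" using A[OF xcl] vm by (cases "fst x \<le> A") simp_all
        moreover have "fst x < L + R2"
          using right'[OF xcl] vm R2(1) by (cases "L + R0 < fst x") simp_all
        ultimately have "\<forall>\<^sub>F z in nhds x. z \<in> {z. A < fst z} \<inter> {z. fst z < L + R2}"
          by (intro eventually_nhds_in_open open_Int open_Collect_less continuous_intros) auto
        then have near: "\<forall>\<^sub>F z in nhds x. A < fst z \<and> fst z < L + R2" by simp
        have 1: "\<forall>\<^sub>F z in nhds x. z \<in> closure \<Omega> \<longrightarrow> ramp (fst z + t) \<le> v z"
          using near by eventually_elim (use le in \<open>simp add: K_def\<close>)
        have 2: "\<forall>\<^sub>F z in nhds x. z \<in> frontier \<Omega> \<longrightarrow> fst (outward_normal \<Omega> z) \<le> 0"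
          using near by eventually_elim (use widening R2(2) in simp)
        show False by (rule ramp_touching[OF xcl touch 1 2])
      qed
    qed
    show ?thesis
    proof (rule ccontr)
      assume "\<not> m \<le> v y"
      then have q: "(m - v y) / (m - m1) > 0" (is "?q > 0") using m1 by simp
      \<comment> \<open>At this \<open>z\<close> the exponential cap has risen at least to \<open>v y\<close>.\<close>
      define z where "z = \<bar>ln ?q\<bar> / b"
      have z: "0 \<le> z" "- b * z \<le> ln ?q" using b by (auto simp: z_def)
      have "exp (- b * z) \<le> exp (ln ?q)" using z(2) by (simp only: exp_le_cancel_iff)
      then have "exp (- b * z) \<le> ?q" using q by simp
      then have "(m - m1) * exp (- b * z) \<le> m - v y" using m1 by (simp add: field_simps)
      then have "v y \<le> ramp z" by (simp add: ramp_pos[OF z(1)])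
      moreover have "ramp z < v y" using below[of "z - fst y"] by simp
      ultimately show False by simp
    qed
  qed
  define \<mu> where "\<mu> = Inf (v ` closure \<Omega>)"
  have bb: "bdd_below (v ` closure \<Omega>)" using nonneg by (intro bdd_belowI[of _ 0]) auto
  have \<mu>le: "\<mu> \<le> v y" if "y \<in> closure \<Omega>" for y
    unfolding \<mu>_def using bb that by (intro cInf_lower) auto
  have xcl: "x \<in> closure \<Omega>" using x sub by blast
  have \<mu>: "m \<le> \<mu>" "\<mu> < 1"
  proof -
    have ne: "closure \<Omega> \<noteq> {}" using xcl by auto
    show "m \<le> \<mu>" unfolding \<mu>_def by (rule cINF_greatest[OF ne all_m])
    show "\<mu> < 1" using \<mu>le[OF xcl] vx by simp
  qed
  define k where "k = (\<mu> + 1) / 2"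
  have k: "\<mu> < k" "k < 1" using \<mu> by (auto simp: k_def)
  have "continuous_on {\<mu>..k} F" by (rule continuous_on_subset[OF cont_F]) simp
  then obtain s where s: "s \<in> {\<mu>..k}" "\<And>t. t \<in> {\<mu>..k} \<Longrightarrow> F s \<le> F t"
    using continuous_attains_inf[of "{\<mu>..k}" F] k by auto
  have Fs: "F s > 0" using s(1) k \<mu> m1 by (intro F_pos) auto
  define N where "N = real DIM(real \<times> 'b)"
  have N: "N > 0" by (simp add: N_def)
  define d where "d = F s / (4 * N)"
  have d: "d > 0" "2 * N * d < F s" using Fs N by (auto simp: d_def)
  \<comment> \<open>The first entry lets the penalty exceed the gap on the sphere of radius \<open>R0\<close>, the second one keeps \<open>v\<close>
    in the range \<open>[\<mu>,k]\<close> where \<open>F\<close> is at least \<open>F s\<close>.\<close>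
  define \<tau> where "\<tau> = min (d * R0\<^sup>2) (k - \<mu>)"
  have \<tau>: "\<tau> > 0" using d R0 k by (simp add: \<tau>_def)
  have far: "\<mu> + \<tau> \<le> v y" if y: "y \<in> \<Omega>" "L + R0 < fst y" for y
  proof (rule ccontr)
    assume "\<not> \<mu> + \<tau> \<le> v y"
    then have vy: "v y < \<mu> + \<tau>" by simp
    define g where "g x = v x + d * (norm (x - y))\<^sup>2" for x
    define K where "K = closure \<Omega> \<inter> cball y R0"
    have "compact K" unfolding K_def by (intro closed_Int_compact) auto
    moreover have "continuous_on K g" unfolding g_def
      by (intro continuous_intros continuous_on_subset[OF cont_v]) (simp add: K_def)
    moreover have yK: "y \<in> K" using y sub R0 by (auto simp: K_def)
    ultimately obtain x0 where x0: "x0 \<in> K" "\<And>x. x \<in> K \<Longrightarrow> g x0 \<le> g x"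
      using continuous_attains_inf[of K g] by blast
    have gx0: "g x0 < \<mu> + \<tau>" using x0(2)[OF yK] vy by (simp add: g_def)
    have x0cl: "x0 \<in> closure \<Omega>" using x0(1) by (simp add: K_def)
    have "norm (x0 - y) \<noteq> R0"
    proof
      assume "norm (x0 - y) = R0"
      then have "g x0 = v x0 + d * R0\<^sup>2" by (simp add: g_def)
      moreover have "\<tau> \<le> d * R0\<^sup>2" by (simp add: \<tau>_def)
      ultimately show False using gx0 \<mu>le[OF x0cl] by linarith
    qed
    then have x0in: "x0 \<in> ball y R0" using x0(1) by (auto simp: K_def dist_norm norm_minus_commute)
    then have near: "\<forall>\<^sub>F x in nhds x0. x \<in> ball y R0" by (intro eventually_nhds_in_open) auto
    have "v x0 \<le> g x0" using d by (simp add: g_def)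
    then have "F s \<le> F (v x0)" using gx0 \<mu>le[OF x0cl] by (intro s(2)) (auto simp: \<tau>_def)
    show False
    proof (rule paraboloid_touching[OF x0cl, of "g x0" d y])
      show "g x0 - d * (norm (x0 - y))\<^sup>2 = v x0" by (simp add: g_def)
      show "\<forall>\<^sub>F x in nhds x0. x \<in> closure \<Omega> \<longrightarrow> g x0 - d * (norm (x - y))\<^sup>2 \<le> v x"
        using near by eventually_elim (use x0(2) in \<open>force simp: K_def g_def\<close>)
      show "2 * real DIM(real \<times> 'b) * d < F (v x0)"
        using d(2) \<open>F s \<le> F (v x0)\<close> by (simp add: N_def)
      show "\<forall>\<^sub>F x in nhds x0. x \<in> frontier \<Omega> \<longrightarrow> 0 \<le> d * ((x - y) \<bullet> outward_normal \<Omega> x)"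
        using near
      proof eventually_elim
        case (elim x)
        have "L < fst x"
          using fstn[of x y] elim y(2) by (simp add: dist_norm norm_minus_commute)
        then show ?case using normal[of y x] y R0 d by simp
      qed
    qed
  qed
  have far': "\<mu> + \<tau> \<le> v y" if "y \<in> closure \<Omega>" "L + R0 < fst y" for y
  proof (rule lower_bound_closure[OF _ that])
    show "\<mu> + \<tau> \<le> v z" if "z \<in> \<Omega>" "L + R0 < fst z" for z
      using that by (rule far)
  qed
  obtain A' where "\<forall>x\<in>closure \<Omega>. fst x \<le> A' \<longrightarrow> k < v x" using lim[OF k(2)] ..
  then have A': "k < v x" if "x \<in> closure \<Omega>" "fst x \<le> A'" for x using that by blast
  define K where "K = closure \<Omega> \<inter> {x. A' \<le> fst x \<and> fst x \<le> L + R2}"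
  have outside: "\<mu> + \<tau> \<le> v y" if "y \<in> closure \<Omega>" "y \<notin> K" for y
  proof (cases "fst y \<le> A'")
    case True
    then show ?thesis using A'[OF that(1)] by (simp add: \<tau>_def)
  next
    case False
    then show ?thesis using that R2 by (intro far') (auto simp: K_def)
  qed
  have "v ` closure \<Omega> \<noteq> {}" "Inf (v ` closure \<Omega>) < \<mu> + \<tau>"
    using x sub \<tau> unfolding \<mu>_def[symmetric] by auto
  then have "\<exists>r\<in>v ` closure \<Omega>. r < \<mu> + \<tau>" by (rule cInf_lessD)
  then obtain y where y: "y \<in> closure \<Omega>" "v y < \<mu> + \<tau>" by (rule bexE) (erule imageE, simp add: that)
  then have "y \<in> K" using outside[of y] by (cases "y \<in> K") auto
  moreover have "compact K" unfolding K_def by (rule slice)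
  moreover have "continuous_on K v" by (rule continuous_on_subset[OF cont_v]) (simp add: K_def)
  ultimately obtain x0 where x0: "x0 \<in> K" "\<And>x. x \<in> K \<Longrightarrow> v x0 \<le> v x"
    using continuous_attains_inf[of K v] by blast
  have x0cl: "x0 \<in> closure \<Omega>" using x0(1) by (simp add: K_def)
  have vx0: "v x0 < \<mu> + \<tau>" using x0(2)[OF \<open>y \<in> K\<close>] y(2) by simp
  have "F s \<le> F (v x0)" using vx0 \<mu>le[OF x0cl] by (intro s(2)) (auto simp: \<tau>_def)
  then have "F (v x0) > 0" using Fs by simp
  moreover have "v x0 \<le> v z" if "z \<in> closure \<Omega>" for z
    using x0(2)[of z] outside[OF that] vx0 by (cases "z \<in> K") auto
  ultimately show False
    by (intro paraboloid_touching[OF x0cl, of "v x0" 0 0]) auto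
qed

end

section \<open>The limit state of the front solution\<close>

text \<open>What the elliptic argument needs to know about the limit state. The last property combines \<open>v \<ge> u t\<close> at one very negative time \<open>t\<close>
with the uniform closeness of \<open>u t\<close> to the front, whose limit at \<open>-\<infinity>\<close> is \<open>1\<close>.\<close>

lemma front_limit_properties:
  fixes \<Omega> :: "(real \<times> 'b::euclidean_space) set"
  assumes bis: "bistable f \<theta>" and dom: "uniformly_C2_holder_domain \<alpha> \<Omega>"
    and front: "travelling_front f \<theta> \<phi> c" and sol: "front_solution f \<phi> c \<Omega> u v"
  shows "neumann_solution \<Omega> \<alpha> (clamped f) v"
    and "\<And>x. x \<in> closure \<Omega> \<Longrightarrow> v x \<le> 1"
    and "\<And>k. k < 1 \<Longrightarrow> \<exists>A. \<forall>x\<in>closure \<Omega>. fst x \<le> A \<longrightarrow> k < v x"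
proof -
  have entu: "entire_solution f \<Omega> u" and entv: "entire_solution f \<Omega> (\<lambda>_. v)"
    and u01: "\<And>t x. x \<in> \<Omega> \<Longrightarrow> 0 < u t x \<and> u t x < 1"
    and bot: "uniform_limit (closure \<Omega>) (\<lambda>t x. u t x - \<phi> (fst x - c * t)) (\<lambda>_. 0) at_bot"
    and mon: "\<And>x. x \<in> \<Omega> \<Longrightarrow> mono (\<lambda>t. u t x)" and top: "C2_loc_limit \<Omega> u v at_top"
    using sol unfolding front_solution_def stationary_solution_def by auto
  have slice: "continuous_on (closure \<Omega>) (w t)"
    if "continuous_on (UNIV \<times> closure \<Omega>) (\<lambda>(t, x). w t x)" for w :: "real \<Rightarrow> real \<times> 'b \<Rightarrow> real" and t
  proof -
    have "continuous_on (closure \<Omega>) (\<lambda>x. (\<lambda>(t, x). w t x) (t, x))"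
      by (rule continuous_on_compose2[OF that]) (auto intro!: continuous_intros)
    then show ?thesis by simp
  qed
  have cu: "continuous_on (closure \<Omega>) (u t)" for t
    using entu by (intro slice) (simp add: entire_solution_def)
  have cv: "continuous_on (closure \<Omega>) v"
    using entv slice[of "\<lambda>_. v" 0] by (simp add: entire_solution_def)
  have lim: "((\<lambda>t. u t x) \<longlongrightarrow> v x) at_top" if "x \<in> \<Omega>" for x
  proof -
    have "compact {x} \<and> {x} \<subseteq> \<Omega>" using that by simp
    then have "uniform_limit {x} u v at_top" using top unfolding C2_loc_limit_def by blast
    then show ?thesis by (rule tendsto_uniform_limitI) simp
  qed
  have uv: "u t x \<le> v x" if "x \<in> \<Omega>" for t x
  proof (rule tendsto_lowerbound[OF lim[OF that]])
    show "\<forall>\<^sub>F s in at_top. u t x \<le> u s x"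
      using eventually_ge_at_top[of t] by eventually_elim (rule monoD[OF mon[OF that]])
  qed simp
  have v0: "0 \<le> v x" if "x \<in> closure \<Omega>" for x
    using cv that
  proof (rule continuous_ge_on_closure)
    show "0 \<le> v y" if "y \<in> \<Omega>" for y using u01[OF that, of 0] uv[OF that, of 0] by linarith
  qed
  show v1: "v x \<le> 1" if "x \<in> closure \<Omega>" for x
    using cv that
  proof (rule continuous_le_on_closure)
    show "v y \<le> 1" if "y \<in> \<Omega>" for y
      by (rule tendsto_upperbound[OF lim[OF that]])
        (use u01[OF that] in \<open>auto intro!: always_eventually less_imp_le\<close>)
  qed
  show "neumann_solution \<Omega> \<alpha> (clamped f) v"
  proof
    show "uniformly_C2_holder_domain \<alpha> \<Omega>" by (rule dom)
    show "continuous_on UNIV (clamped f)" using bis by (intro continuous_on_clamped bistable_continuous)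
    show "continuous_on (closure \<Omega>) v" by (rule cv)
    show "C2_on \<Omega> v" using entv by (simp add: entire_solution_def)
    show "laplacian v x + clamped f (v x) = 0" if "x \<in> \<Omega>" for x
    proof -
      have "deriv (\<lambda>s. v x) 0 - laplacian v x = f (v x)" using entv that by (simp add: entire_solution_def)
      moreover have "x \<in> closure \<Omega>" using that by (rule subsetD[OF closure_subset])
      then have "clamped f (v x) = f (v x)" using v0[of x] v1[of x] by (simp add: clamped_eq)
      ultimately show ?thesis by simp
    qed
    show "\<exists>\<gamma>. (v has_derivative (\<lambda>h. h \<bullet> \<gamma>)) (at x within closure \<Omega>) \<and> \<gamma> \<bullet> outward_normal \<Omega> x = 0"
      if "x \<in> frontier \<Omega>" for x
    proof -
      obtain G where G: "\<And>(t::real) x. x \<in> closure \<Omega> \<Longrightarrow> (v has_derivative (\<lambda>h. h \<bullet> G t x)) (at x within closure \<Omega>)"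
        "\<And>(t::real) x. x \<in> frontier \<Omega> \<Longrightarrow> G t x \<bullet> outward_normal \<Omega> x = 0"
        using entv unfolding entire_solution_def neumann_condition_def by blast
      have "x \<in> closure \<Omega>" using that by (simp add: frontier_def)
      then show ?thesis using G(1)[of x 0] G(2)[OF that, of 0] by blast
    qed
    show "0 \<le> v x" if "x \<in> closure \<Omega>" for x using that by (rule v0)
  qed
  show "\<exists>A. \<forall>x\<in>closure \<Omega>. fst x \<le> A \<longrightarrow> k < v x" if k: "k < 1" for k
  proof -
    define e where "e = (1 - k) / 2"
    have e: "e > 0" using k by (simp add: e_def)
    have "(\<phi> \<longlongrightarrow> 1) at_bot" using front by (simp add: travelling_front_def)
    then have "\<forall>\<^sub>F z in at_bot. 1 - e < \<phi> z" using e by (intro order_tendstoD) auto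
    then obtain Z where Z: "\<And>z. z \<le> Z \<Longrightarrow> 1 - e < \<phi> z" unfolding eventually_at_bot_linorder by blast
    obtain t where t: "\<And>x. x \<in> closure \<Omega> \<Longrightarrow> dist (u t x - \<phi> (fst x - c * t)) 0 < e"
      using uniform_limitD[OF bot e] unfolding eventually_at_bot_linorder by blast
    have "k < v x" if x: "x \<in> closure \<Omega>" "fst x \<le> Z + c * t" for x
    proof -
      have "continuous_on (closure \<Omega>) (\<lambda>x. v x - u t x)" by (intro continuous_intros cu cv)
      then have "0 \<le> v x - u t x"
        using x(1) by (rule continuous_ge_on_closure) (use uv in simp)
      moreover have "1 - e < \<phi> (fst x - c * t)" using x(2) by (intro Z) simp
      moreover have "\<bar>u t x - \<phi> (fst x - c * t)\<bar> < e" using t[OF x(1)] by (simp add: dist_real_def)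
      moreover have "k = 1 - e - e" by (simp add: e_def field_simps)
      ultimately show ?thesis by linarith
    qed
    then show ?thesis by blast
  qed
qed

theorem theorem1p13:
  fixes f :: "real \<Rightarrow> real" and \<theta> :: real
  assumes "bistable f \<theta>"
  shows "\<exists>R\<^sub>1>0. \<forall>(\<Omega> :: (real \<times> (real ^ 'n)) set) \<alpha> \<omega> \<phi> c u u_inf R L C.
           0 < \<alpha> \<and> \<alpha> < 1 \<and> uniformly_C2_holder_domain \<alpha> \<Omega> \<and> \<not> bounded \<Omega> \<and>
           open \<omega> \<and> \<Omega> \<inter> {x. fst x < 0} = {..<0} \<times> \<omega> \<and>
           travelling_front f \<theta> \<phi> c \<and>
           front_solution f \<phi> c \<Omega> u u_inf \<and>
           R > R\<^sub>1 \<and> L > 0 \<and> C > 0 \<and>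
           UNIV \<times> ball 0 R \<subseteq> \<Omega> \<and>
           convex {x \<in> \<Omega>. fst x > L} \<and>
           {x \<in> \<Omega>. fst x < L + R} \<subseteq> UNIV \<times> ball 0 C \<and>
           (\<forall>x\<in>frontier \<Omega>. fst x < L + R \<longrightarrow> fst (outward_normal \<Omega> x) \<le> 0)
           \<longrightarrow> (\<forall>x\<in>\<Omega>. u_inf x = 1)"
proof -
  have \<theta>: "0 < \<theta>" "\<And>s. \<theta> < s \<Longrightarrow> s < 1 \<Longrightarrow> 0 < f s"
    using assms by (auto simp: bistable_def)
  obtain m1 m \<kappa> P where m: "\<theta> < m1" "m1 < m" "m < 1" and \<kappa>: "\<kappa> > 0" "\<And>s. s \<in> {m1..m} \<Longrightarrow> \<kappa> \<le> f s"
    and prof: "\<And>p. 0 < p \<Longrightarrow> p \<le> 1 \<Longrightarrow> \<exists>h h' \<rho> J. h 0 = m1 \<and> h' 0 = - p \<and> \<rho> > 0 \<and> h \<rho> = 0 \<and>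
       (\<forall>r. (h has_real_derivative h' r) (at r)) \<and> (\<forall>r. - P \<le> h' r \<and> h' r < 0) \<and>
       open J \<and> {0..\<rho>} \<subseteq> J \<and> (\<forall>r\<in>J. (h' has_real_derivative \<kappa> - clamped f (h r)) (at r))"
    by (rule bistable_profile[OF assms]) (rule that)
  \<comment> \<open>Order of the choices: \<open>r1\<close> is large in terms of \<open>N\<close>, \<open>\<kappa>\<close>, \<open>\<delta>\<close> and \<open>P\<close>; then \<open>a\<close> lets the paraboloid drop
    from \<open>m\<close> to \<open>m1\<close> over the length \<open>r1\<close>; the slope \<open>p\<close> of the tail comes last, and determines \<open>\<rho>\<close>.\<close>
  define N where "N = real DIM(real \<times> (real ^ 'n))"
  define \<delta> where "\<delta> = m - m1"
  define r1 where "r1 = 1 + 2 * N * \<delta> / \<kappa> + \<bar>N * P\<bar> / \<kappa>"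
  define a where "a = \<delta> / r1\<^sup>2"
  define b where "b = min 1 (\<kappa> / (2 * \<delta>))"
  define p where "p = min 1 (min (a * r1) (\<delta> * b / 2))"
  have N: "N > 0" by (simp add: N_def)
  have \<delta>: "\<delta> > 0" using m by (simp add: \<delta>_def)
  have "2 * N * \<delta> / \<kappa> > 0" "\<bar>N * P\<bar> / \<kappa> \<ge> 0" using N \<delta> \<kappa> by auto
  then have r1: "r1 \<ge> 1" "2 * N * \<delta> / \<kappa> < r1" "\<bar>N * P\<bar> / \<kappa> < r1" by (simp_all add: r1_def)
  have a: "a > 0" "a * r1\<^sup>2 = \<delta>" using \<delta> r1(1) by (auto simp: a_def)
  have aN: "2 * N * a < \<kappa>"
  proof -
    have "2 * N * \<delta> < \<kappa> * r1" using r1(2) \<kappa>(1) by (simp add: field_simps)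
    also have "\<dots> \<le> \<kappa> * r1\<^sup>2" using r1(1) \<kappa>(1) by (simp add: power2_eq_square)
    finally show ?thesis using r1(1) by (simp add: a_def field_simps)
  qed
  have NP: "N * P < \<kappa> * r1"
  proof -
    have "\<bar>N * P\<bar> < \<kappa> * r1" using r1(3) \<kappa>(1) by (simp add: field_simps)
    then show ?thesis by linarith
  qed
  have b: "b > 0" "b \<le> 1" using \<delta> \<kappa> by (auto simp: b_def)
  have bk: "\<delta> * b\<^sup>2 < \<kappa>"
  proof -
    have "\<delta> * b\<^sup>2 \<le> \<delta> * b" using b \<delta> by (simp add: power2_eq_square)
    also have "\<dots> \<le> \<delta> * (\<kappa> / (2 * \<delta>))" using \<delta> by (intro mult_left_mono) (auto simp: b_def)
    also have "\<dots> < \<kappa>" using \<delta> \<kappa> by simp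
    finally show ?thesis .
  qed
  have "a * r1 > 0" "\<delta> * b > 0" using a b \<delta> r1 by auto
  then have p: "0 < p" "p \<le> 1" "p < 2 * a * r1" "p < \<delta> * b" by (auto simp: p_def)
  obtain h h' \<rho> J where h: "h 0 = m1" "h' 0 = - p" "\<rho> > 0" "h \<rho> = 0"
    "\<And>r. (h has_real_derivative h' r) (at r)" "\<And>r. - P \<le> h' r" "\<And>r. h' r < 0"
    "open J" "{0..\<rho>} \<subseteq> J" "\<And>r. r \<in> J \<Longrightarrow> (h' has_real_derivative \<kappa> - clamped f (h r)) (at r)"
    using prof[OF p(1,2)] by blast
  have main: "u_inf x = 1"
    if \<Omega>: "uniformly_C2_holder_domain \<alpha> \<Omega>" and front: "travelling_front f \<theta> \<phi> c"
      and sol: "front_solution f \<phi> c \<Omega> u u_inf" and R: "R > r1 + \<rho>"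
      and geo: "UNIV \<times> ball 0 R \<subseteq> \<Omega>" "convex {x \<in> \<Omega>. fst x > L}"
        "{x \<in> \<Omega>. fst x < L + R} \<subseteq> UNIV \<times> ball 0 C"
        "\<forall>x\<in>frontier \<Omega>. fst x < L + R \<longrightarrow> fst (outward_normal \<Omega> x) \<le> 0"
      and x: "x \<in> \<Omega>"
    for \<Omega> :: "(real \<times> (real ^ 'n)) set" and \<alpha> \<phi> c u u_inf R L C x
  proof -
    note props = front_limit_properties[OF assms \<Omega> front sol]
    interpret neumann_solution \<Omega> \<alpha> "clamped f" u_inf by (rule props(1))
    interpret profile_solution \<Omega> \<alpha> "clamped f" u_inf \<kappa> m1 m p P \<rho> a r1 b h h' J
    proof
      show "\<kappa> \<le> clamped f s" if "s \<in> {m1..m}" for s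
        using \<kappa>(2)[OF that] that m \<theta>(1) by (simp add: clamped_eq)
    qed (use \<kappa>(1) m \<theta>(1) h r1(1) a aN NP b bk p in \<open>simp_all add: \<delta>_def N_def\<close>)
    show ?thesis
    proof (rule solution_eq_1[OF m(3) _ props(2,3) R geo(1-3)])
      show "0 < clamped f s" if "m1 \<le> s" "s < 1" for s
        using \<theta>(2)[of s] that m \<theta>(1) by (simp add: clamped_eq)
    qed (use geo(4) x in auto)
  qed
  show ?thesis
  proof (intro exI[of _ "r1 + \<rho>"] conjI allI impI ballI)
    show "0 < r1 + \<rho>" using r1(1) h(3) by simp
  qed (use main in blast)
qed

end
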